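(* Let $k \geq 2$ be an integer and let $\alpha$ be a real number such that $k^\alpha$ is irrational. Then the formal power series $$f(x_0, x_1, \dots, x_{k-1}) = \sum_{n \geq 0} \left\lfloor \alpha + \log_k (n+1) \right\rfloor \tau(n)$$ in the $k$ non-commuting variables $x_0, x_1, \dots, x_{k-1}$ is not algebraic.
   Context: For an integer $n \geq 1$ with standard base-$k$ representation $n = n_l \cdots n_1 n_0$ (digits $n_j \in \{0, 1, \dots, k-1\}$, $n_l \neq 0$, $n_0$ the least significant digit), $\tau(n)$ denotes the word $\tau(n) = x_{n_0} x_{n_1} \cdots x_{n_l}$ in the non-commuting variables $x_0, \dots, x_{k-1}$; $\tau(0)$ is the empty word (the monomial $1$). Algebraicity of a formal power series in non-commuting variables is meant in the standard sense: let $X = \{x_0, \dots, x_{k-1}\}$ and let $Y = \{y_1, \dots, y_r\}$ be a finite set of further non-commuting variables. A proper algebraic system is a system of equations $y_i = p_i$ ($1 \leq i \leq r$), where each $p_i$ is a polynomial with rational coefficients in the non-commuting variables $X \cup Y$ having no constant term and no term of the form $c\, y_j$ with $c \neq 0$. Such a system has a unique solution $(s_1, \dots, s_r)$ in formal power series in the non-commuting variables $X$ over $\mathbb{Q}$ with zero constant terms. A formal power series $f$ over $\mathbb{Q}$ in the non-commuting variables $X$ is algebraic if $f$ minus its constant term is a component of the solution of some proper algebraic system. *)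

theory Defs
  imports Complex_Main "HOL-Library.Poly_Mapping"
begin

section \<open>Formal power series and polynomials in non-commuting variables\<close>

text \<open>
  A monomial is a word (list) of variables, and a series is the function giving the coefficient of
  each word. The variables of a series range over a set \<open>X\<close>, see \<open>nc_series_on\<close>.
\<close>

type_synonym 'x nc_series = "'x list \<Rightarrow> rat"

definition nc_series_on :: "'x set \<Rightarrow> 'x nc_series \<Rightarrow> bool" where
  "nc_series_on X f \<longleftrightarrow> {w. f w \<noteq> 0} \<subseteq> lists X"

definition nc_one :: "'x nc_series" where
  "nc_one = (\<lambda>w. if w = [] then 1 else 0)"

definition nc_var :: "'x \<Rightarrow> 'x nc_series" where
  "nc_var x = (\<lambda>w. if w = [x] then 1 else 0)"

definition nc_mult :: "'x nc_series \<Rightarrow> 'x nc_series \<Rightarrow> 'x nc_series" where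
  "nc_mult f g = (\<lambda>w. \<Sum>i\<le>length w. f (take i w) * g (drop i w))"

text \<open>
  Polynomials in the variables \<open>X \<union> Y\<close> with \<open>Y = {y\<^sub>0, \<dots>, y\<^sub>r\<^sub>-\<^sub>1}\<close>: the letter \<open>Inl x\<close> is the variable
  \<open>x\<close>, the letter \<open>Inr j\<close> is \<open>y\<^sub>j\<close>. Only the additive structure of the type of finitely
  supported functions is relevant here.
\<close>

type_synonym 'x nc_poly = "('x + nat) list \<Rightarrow>\<^sub>0 rat"

definition nc_poly_on :: "'x set \<Rightarrow> nat \<Rightarrow> 'x nc_poly \<Rightarrow> bool" where
  "nc_poly_on X r p \<longleftrightarrow> Poly_Mapping.keys p \<subseteq> lists (X <+> {..<r})"

primrec nc_subst_letter :: "(nat \<Rightarrow> 'x nc_series) \<Rightarrow> 'x + nat \<Rightarrow> 'x nc_series" where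
  "nc_subst_letter s (Inl x) = nc_var x"
| "nc_subst_letter s (Inr j) = s j"

primrec nc_subst_word :: "(nat \<Rightarrow> 'x nc_series) \<Rightarrow> ('x + nat) list \<Rightarrow> 'x nc_series" where
  "nc_subst_word s [] = nc_one"
| "nc_subst_word s (a # u) = nc_mult (nc_subst_letter s a) (nc_subst_word s u)"

text \<open>The series obtained from \<open>p\<close> by substituting \<open>s j\<close> for \<open>y\<^sub>j\<close>.\<close>

definition nc_subst :: "(nat \<Rightarrow> 'x nc_series) \<Rightarrow> 'x nc_poly \<Rightarrow> 'x nc_series" where
  "nc_subst s p =
     (\<lambda>w. \<Sum>u\<in>Poly_Mapping.keys p. Poly_Mapping.lookup p u * nc_subst_word s u w)"


section \<open>Algebraic series\<close>

definition proper_system :: "'x set \<Rightarrow> nat \<Rightarrow> (nat \<Rightarrow> 'x nc_poly) \<Rightarrow> bool" where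
  "proper_system X r p \<longleftrightarrow>
     (\<forall>i<r. nc_poly_on X r (p i) \<and> Poly_Mapping.lookup (p i) [] = 0 \<and>
            (\<forall>j<r. Poly_Mapping.lookup (p i) [Inr j] = 0))"

definition system_solution ::
    "'x set \<Rightarrow> nat \<Rightarrow> (nat \<Rightarrow> 'x nc_poly) \<Rightarrow> (nat \<Rightarrow> 'x nc_series) \<Rightarrow> bool" where
  "system_solution X r p s \<longleftrightarrow>
     (\<forall>i<r. nc_series_on X (s i) \<and> s i [] = 0 \<and> s i = nc_subst s (p i))"

text \<open>
  A proper system has exactly one solution (on the indices below \<open>r\<close>), so it does not matter that
  the solution is quantified existentially.
\<close>

definition nc_algebraic :: "'x set \<Rightarrow> 'x nc_series \<Rightarrow> bool" where
  "nc_algebraic X f \<longleftrightarrow> nc_series_on X f \<and>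
     (\<exists>r p s i. proper_system X r p \<and> system_solution X r p s \<and> i < r \<and> f([] := 0) = s i)"


section \<open>Words of base-\<open>k\<close> digits\<close>

text \<open>
  The variable \<open>x\<^sub>d\<close> is represented by the digit \<open>d\<close>. The least significant digit comes first; the
  guard \<open>k \<le> 1\<close> only serves termination.
\<close>

function digit_word :: "nat \<Rightarrow> nat \<Rightarrow> nat list" where
  "digit_word k n = (if n = 0 \<or> k \<le> 1 then [] else (n mod k) # digit_word k (n div k))"
  by auto
termination
  by (relation "measure snd") auto

declare digit_word.simps [simp del]

lemma digit_word_0 [simp]: "digit_word k 0 = []"
  by (simp add: digit_word.simps)

lemma digit_word_rec:
  "k \<ge> 2 \<Longrightarrow> n > 0 \<Longrightarrow> digit_word k n = (n mod k) # digit_word k (n div k)"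
  by (simp add: digit_word.simps [of k n])

lemma digit_word_in_lists: "digit_word k n \<in> lists {..<k}"
proof (induction k n rule: digit_word.induct)
  case (1 k n)
  show ?case
  proof (cases "n = 0 \<or> k \<le> 1")
    case True
    then show ?thesis by (subst digit_word.simps) simp
  next
    case False
    with 1 have "digit_word k (n div k) \<in> lists {..<k}" by blast
    moreover have "digit_word k n = (n mod k) # digit_word k (n div k)"
      using False by (intro digit_word_rec) simp_all
    moreover have "n mod k < k" using False by simp
    ultimately show ?thesis by (simp only: Cons_in_lists_iff lessThan_iff)
  qed
qed

lemma horner_sum_digit_word:
  assumes "k \<ge> 2"
  shows "horner_sum (\<lambda>d. d) k (digit_word k n) = n"
proof (induction n rule: less_induct)
  case (less n)
  show ?case
  proof (cases "n = 0")
    case False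
    with less assms have "horner_sum (\<lambda>d. d) k (digit_word k (n div k)) = n div k" by simp
    with False assms show ?thesis by (simp only: digit_word_rec horner_sum_simps) simp
  qed simp
qed

lemma last_digit_word:
  assumes "k \<ge> 2" "n > 0"
  shows "last (digit_word k n) \<noteq> 0"
  using assms(2)
proof (induction n rule: less_induct)
  case (less n)
  show ?case
  proof (cases "n < k")
    case True
    have "digit_word k n = [n]"
      using digit_word_rec [OF assms(1) less.prems] True by simp
    with less.prems show ?thesis by simp
  next
    case False
    then have pos: "n div k > 0" using assms(1) by (simp add: div_greater_zero_iff)
    moreover have "n div k < n" using assms(1) less.prems by simp
    ultimately have "last (digit_word k (n div k)) \<noteq> 0" by (rule less.IH [rotated])
    then show ?thesis
      by (simp add: digit_word_rec [OF assms(1) less.prems] digit_word_rec [OF assms(1) pos])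
  qed
qed

lemma inj_digit_word: "k \<ge> 2 \<Longrightarrow> inj (digit_word k)"
  by (rule inj_on_inverseI) (rule horner_sum_digit_word)


section \<open>The series\<close>

text \<open>
  The formal sum of \<open>c n\<close> times the word of \<open>n\<close> over all \<open>n\<close>, taken coefficientwise. For
  \<open>k \<ge> 2\<close> the index set below has at most one element.
\<close>

definition digit_series :: "nat \<Rightarrow> (nat \<Rightarrow> rat) \<Rightarrow> nat nc_series" where
  "digit_series k c = (\<lambda>w. \<Sum>n | digit_word k n = w. c n)"

lemma digit_series_digit_word:
  assumes "k \<ge> 2"
  shows "digit_series k c (digit_word k n) = c n"
proof -
  have "{m. digit_word k m = digit_word k n} = {n}"
    using inj_eq [OF inj_digit_word [OF assms]] by simp
  then show ?thesis
    by (simp add: digit_series_def)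
qed

lemma digit_series_eq_0: "w \<notin> range (digit_word k) \<Longrightarrow> digit_series k c w = 0"
  unfolding digit_series_def by (rule sum.neutral) fast

lemma nc_series_on_digit_series: "nc_series_on {..<k} (digit_series k c)"
  unfolding nc_series_on_def
proof (rule subsetI)
  fix w assume "w \<in> {w. digit_series k c w \<noteq> 0}"
  then have "w \<in> range (digit_word k)" using digit_series_eq_0 [of w k c] by fast
  then show "w \<in> lists {..<k}" using digit_word_in_lists by fast
qed

end

theory Submission
  imports Defs "HOL-Computational_Algebra.Computational_Algebra"
begin

text \<open>
  The series counts, up to an explicit part, the words of length \<open>m\<close> whose value is at least
  \<open>\<lfloor>\<beta> k\<^sup>m\<rfloor>\<close>, where \<open>\<beta> = k\<close> powr \<open>(\<lfloor>\<alpha>\<rfloor> - \<alpha>)\<close> is irrational. Replace every variable by one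
  commuting variable \<open>z\<close> to get a power series \<open>F\<close>; then the coefficients of \<open>(1 - k z)\<^sup>2 F\<close> are
  bounded integers, and all but the first few are linear combinations of two consecutive base-\<open>k\<close>
  digits of \<open>\<beta>\<close>.

  If the series in non-commuting variables is algebraic, then \<open>F\<close> is a component of the solution of a
  proper system over \<open>\<rat>[z]\<close>, hence algebraic over \<open>\<rat>(z)\<close>, hence so is \<open>(1 - k z)\<^sup>2 F\<close>. An algebraic
  power series satisfies a linear differential equation with polynomial coefficients, so its
  coefficients satisfy a linear recurrence with polynomial coefficients. Since they are bounded
  integers, the terms of highest degree in \<open>n\<close> must cancel for large \<open>n\<close>. This is a recurrence with
  constant coefficients, so the generating function of the digits of \<open>\<beta>\<close> is rational, and
  evaluating it at \<open>1 / k\<close> shows that \<open>\<beta>\<close> is rational.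
\<close>

section \<open>Linear dependence over an integral domain\<close>

text \<open>Gaussian elimination without division: rows are cross-multiplied with a nonzero pivot,
  so the solution stays in the integral domain. Later the coefficients are polynomials in a
  parameter.\<close>

lemma homogeneous_system_nontrivial_solution:
  fixes M :: "'j \<Rightarrow> 'i \<Rightarrow> 'a :: idom"
  assumes "finite J" "finite I" "card J < card I"
  shows "\<exists>x. (\<exists>i\<in>I. x i \<noteq> 0) \<and> (\<forall>j\<in>J. (\<Sum>i\<in>I. M j i * x i) = 0)"
  using assms
proof (induction J arbitrary: I M rule: finite_induct)
  case empty
  then have "I \<noteq> {}" by auto
  then show ?case by (intro exI [of _ "\<lambda>_. 1"]) auto
next
  case (insert j J)
  show ?case
  proof (cases "\<forall>i\<in>I. M j i = 0")
    case True
    have "card J < card I" using insert by simp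
    then obtain x where "\<exists>i\<in>I. x i \<noteq> 0" "\<forall>j\<in>J. (\<Sum>i\<in>I. M j i * x i) = 0"
      using insert.IH [OF insert.prems(1)] by blast
    with True show ?thesis by (intro exI [of _ x]) auto
  next
    case False
    then obtain p where p: "p \<in> I" "M j p \<noteq> 0" by blast
    define I' where "I' = I - {p}"
    have fin: "finite I'" and card: "card J < card I'"
      using insert p by (auto simp: I'_def)
    define N where "N = (\<lambda>l i. M j p * M l i - M l p * M j i)"
    obtain y where y: "\<exists>i\<in>I'. y i \<noteq> 0" "\<And>l. l \<in> J \<Longrightarrow> (\<Sum>i\<in>I'. N l i * y i) = 0"
      using insert.IH [OF fin card] by blast
    \<comment> \<open>Back substitution scaled by the pivot: row \<open>j\<close> vanishes for every
      \<open>y\<close>, and row \<open>l\<close> turns into the reduced row \<open>N l\<close>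
      applied to \<open>y\<close>.\<close>
    define x where "x = (\<lambda>i. if i = p then - (\<Sum>i\<in>I'. M j i * y i) else M j p * y i)"
    have sum_I: "(\<Sum>i\<in>I. g i * x i) = - g p * (\<Sum>i\<in>I'. M j i * y i) + M j p * (\<Sum>i\<in>I'. g i * y i)"
      for g
    proof -
      have "(\<Sum>i\<in>I. g i * x i) = g p * x p + (\<Sum>i\<in>I'. g i * x i)"
        unfolding I'_def using insert.prems(1) p(1) by (rule sum.remove)
      also have "(\<Sum>i\<in>I'. g i * x i) = (\<Sum>i\<in>I'. M j p * (g i * y i))"
        by (rule sum.cong) (auto simp: x_def I'_def)
      also have "g p * x p = - g p * (\<Sum>i\<in>I'. M j i * y i)" by (simp add: x_def)
      finally show ?thesis by (simp only: sum_distrib_left [of "M j p"])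
    qed
    have "(\<Sum>i\<in>I. M l i * x i) = 0" if "l \<in> insert j J" for l
    proof (cases "l = j")
      case True
      then show ?thesis by (simp add: sum_I)
    next
      case False
      with that have "l \<in> J" by simp
      from y(2) [OF this] show ?thesis
        unfolding sum_I by (simp add: N_def algebra_simps sum_subtractf sum_distrib_left sum_negf)
    qed
    moreover obtain i where "i \<in> I'" "y i \<noteq> 0" using y(1) by blast
    then have "i \<in> I" "x i \<noteq> 0" using p by (auto simp: x_def I'_def)
    ultimately show ?thesis by blast
  qed
qed

section \<open>Spans of power series with bounded powers of the variable\<close>

global_interpretation fps_module: module "\<lambda>(c :: 'a :: comm_ring_1) f. fps_const c * f"
  defines fps_span = fps_module.span
  by standard (simp_all add: algebra_simps flip: fps_const_add fps_const_mult)

text \<open>Combinations of elements of \<open>G\<close> with polynomial coefficients of degree at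
  most \<open>m\<close>. Only constants act as scalars, so that generators can be counted.\<close>

definition xspan :: "'a :: comm_ring_1 fps set \<Rightarrow> nat \<Rightarrow> 'a fps set" where
  "xspan G m = fps_span ((\<lambda>(i, g). fps_X ^ i * g) ` ({..m} \<times> G))"

lemma xspan_base: "i \<le> m \<Longrightarrow> g \<in> G \<Longrightarrow> fps_X ^ i * g \<in> xspan G m"
  unfolding xspan_def by (rule fps_module.span_base) auto

lemma xspan_superset: "g \<in> G \<Longrightarrow> g \<in> xspan G m"
  using xspan_base [of 0 m g G] by simp

lemma xspan_zero: "0 \<in> xspan G m"
  and xspan_add: "x \<in> xspan G m \<Longrightarrow> y \<in> xspan G m \<Longrightarrow> x + y \<in> xspan G m"
  and xspan_diff: "x \<in> xspan G m \<Longrightarrow> y \<in> xspan G m \<Longrightarrow> x - y \<in> xspan G m"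
  and xspan_neg: "x \<in> xspan G m \<Longrightarrow> - x \<in> xspan G m"
  and xspan_scale: "x \<in> xspan G m \<Longrightarrow> fps_const c * x \<in> xspan G m"
  and xspan_sum: "(\<And>i. i \<in> I \<Longrightarrow> f i \<in> xspan G m) \<Longrightarrow> sum f I \<in> xspan G m"
  unfolding xspan_def
  by (rule fps_module.span_zero fps_module.span_add fps_module.span_diff fps_module.span_neg
      fps_module.span_scale fps_module.span_sum; assumption)+

lemma xspan_mono: "G \<subseteq> H \<Longrightarrow> m \<le> n \<Longrightarrow> x \<in> xspan G m \<Longrightarrow> x \<in> xspan H n"
  unfolding xspan_def by (rule subsetD [OF fps_module.span_mono]) auto

lemma xspan_induct [consumes 1, case_names zero step]:
  assumes "x \<in> xspan G m" and "P 0"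
    and "\<And>c i g y. i \<le> m \<Longrightarrow> g \<in> G \<Longrightarrow> P y \<Longrightarrow> P (fps_const c * (fps_X ^ i * g) + y)"
  shows "P x"
  using assms(1) unfolding xspan_def
  by (induction rule: fps_module.span_induct_alt) (use assms(2,3) in auto)

lemma xspan_X_power_mult: "x \<in> xspan G m \<Longrightarrow> fps_X ^ n * x \<in> xspan G (n + m)"
proof (induction rule: xspan_induct)
  case zero
  then show ?case by (simp add: xspan_zero)
next
  case (step c i g y)
  have "fps_X ^ (n + i) * g \<in> xspan G (n + m)" using step by (intro xspan_base) auto
  then have "fps_const c * (fps_X ^ (n + i) * g) + fps_X ^ n * y \<in> xspan G (n + m)"
    using step by (intro xspan_add xspan_scale)
  then show ?case by (simp add: algebra_simps power_add)
qed

text \<open>Degrees add: if multiplication by \<open>y\<close> needs \<open>n\<close> powers of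
  \<open>fps_X\<close> on the generators, it adds the same \<open>n\<close> on the whole
  span.\<close>

lemma xspan_mult:
  assumes "x \<in> xspan G m" and "\<And>g. g \<in> G \<Longrightarrow> y * g \<in> xspan H n"
  shows "y * x \<in> xspan H (m + n)"
  using assms(1)
proof (induction rule: xspan_induct)
  case zero
  then show ?case by (simp add: xspan_zero)
next
  case (step c i g z)
  have "fps_X ^ i * (y * g) \<in> xspan H (i + n)" using step assms by (intro xspan_X_power_mult)
  then have "fps_X ^ i * (y * g) \<in> xspan H (m + n)"
    by (rule xspan_mono [rotated 2]) (use step in auto)
  then have "fps_const c * (fps_X ^ i * (y * g)) + y * z \<in> xspan H (m + n)"
    using step by (intro xspan_add xspan_scale)
  then show ?case by (simp add: algebra_simps)
qed

lemma fps_const_sum: "fps_const (\<Sum>i\<in>I. f i) = (\<Sum>i\<in>I. fps_const (f i))"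
  by (simp add: fps_eq_iff fps_sum_nth)

lemma fps_of_poly_eq_sum:
  fixes q :: "'a :: comm_ring_1 poly"
  shows "fps_of_poly q = (\<Sum>i\<le>degree q. fps_const (coeff q i) * fps_X ^ i)"
  using arg_cong [OF poly_as_sum_of_monoms [of q], of fps_of_poly]
  by (simp add: fps_of_poly_sum fps_of_poly_monom)

lemma xspan_poly_mult:
  assumes "x \<in> xspan G m"
  shows "fps_of_poly q * x \<in> xspan G (degree q + m)"
proof -
  have "fps_const (coeff q i) * (fps_X ^ i * x) \<in> xspan G (degree q + m)" if "i \<le> degree q" for i
    using xspan_X_power_mult [OF assms, of i] that
    by (intro xspan_scale) (rule xspan_mono [rotated 2], auto)
  then show ?thesis
    unfolding fps_of_poly_eq_sum [of q] sum_distrib_right by (intro xspan_sum) (auto simp: mult.assoc)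
qed

text \<open>At most \<open>(m + 1) * card G\<close> products generate the span, so expanding more
  elements than that in the generators gives a homogeneous system with more unknowns than
  equations.\<close>

lemma xspan_dependent:
  fixes v :: "'i \<Rightarrow> 'a :: idom fps"
  assumes "finite G" "finite I" "(m + 1) * card G < card I" "\<And>i. i \<in> I \<Longrightarrow> v i \<in> xspan G m"
  shows "\<exists>x. (\<exists>i\<in>I. x i \<noteq> 0) \<and> (\<Sum>i\<in>I. fps_const (x i) * v i) = 0"
proof -
  define J where "J = (\<lambda>(i, g :: 'a fps). fps_X ^ i * g) ` ({..m} \<times> G)"
  have fin: "finite J" using assms(1) by (simp add: J_def)
  have "card J \<le> card ({..m} \<times> G)" unfolding J_def using assms(1) by (intro card_image_le) simp
  also have "\<dots> = (m + 1) * card G" by (simp add: card_cartesian_product)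
  finally have card: "card J < card I" using assms(3) by simp
  have "\<exists>u. v i = (\<Sum>g\<in>J. fps_const (u g) * g)" if "i \<in> I" for i
    using assms(4) [OF that] fps_module.span_finite [OF fin]
    unfolding xspan_def J_def [symmetric] by auto
  then obtain u where u: "\<And>i. i \<in> I \<Longrightarrow> v i = (\<Sum>g\<in>J. fps_const (u i g) * g)" by metis
  obtain x where x: "\<exists>i\<in>I. x i \<noteq> 0" "\<And>g. g \<in> J \<Longrightarrow> (\<Sum>i\<in>I. u i g * x i) = 0"
    using homogeneous_system_nontrivial_solution [OF fin assms(2) card, of "\<lambda>g i. u i g"] by blast
  have "(\<Sum>i\<in>I. fps_const (x i) * v i) = (\<Sum>i\<in>I. \<Sum>g\<in>J. fps_const (u i g * x i) * g)"
    by (intro sum.cong refl) (simp add: u sum_distrib_left mult_ac flip: fps_const_mult)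
  also have "\<dots> = (\<Sum>g\<in>J. \<Sum>i\<in>I. fps_const (u i g * x i) * g)" by (rule sum.swap)
  also have "\<dots> = (\<Sum>g\<in>J. fps_const (\<Sum>i\<in>I. u i g * x i) * g)"
    by (simp add: sum_distrib_right fps_const_sum)
  also have "\<dots> = 0" using x(2) by simp
  finally show ?thesis using x(1) by blast
qed

section \<open>Proper systems in commuting variables\<close>

definition word_value :: "(nat \<Rightarrow> 'a :: comm_ring_1 fps) \<Rightarrow> ('x + nat) list \<Rightarrow> 'a fps" where
  "word_value S u = prod_list (map (case_sum (\<lambda>_. fps_X) S) u)"

lemma word_value_simps [simp]:
  "word_value S [] = 1"
  "word_value S (a # u) = case_sum (\<lambda>_. fps_X) S a * word_value S u"
  by (simp_all add: word_value_def)

definition system_rhs ::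
    "(nat \<Rightarrow> ('x + nat) list set) \<Rightarrow> (nat \<Rightarrow> ('x + nat) list \<Rightarrow> 'a :: comm_ring_1) \<Rightarrow>
     (nat \<Rightarrow> 'a fps) \<Rightarrow> nat \<Rightarrow> 'a fps" where
  "system_rhs K c S i = (\<Sum>u\<in>K i. fps_const (c i u) * word_value S u)"

definition solves_system ::
    "nat \<Rightarrow> (nat \<Rightarrow> ('x + nat) list set) \<Rightarrow> (nat \<Rightarrow> ('x + nat) list \<Rightarrow> 'a :: comm_ring_1) \<Rightarrow>
     (nat \<Rightarrow> 'a fps) \<Rightarrow> bool" where
  "solves_system r K c S \<longleftrightarrow> (\<forall>i<r. S i $ 0 = 0 \<and> S i = system_rhs K c S i)"

text \<open>Properness as a condition on supports. The letters \<open>Inl x\<close> are left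
  unrestricted because all of them become \<open>fps_X\<close>.\<close>

definition proper_words :: "nat \<Rightarrow> ('x + nat) list set \<Rightarrow> bool" where
  "proper_words r K \<longleftrightarrow> K \<subseteq> lists (UNIV <+> {..<r}) - {[]} - range (\<lambda>j. [Inr j])"

lemma word_value_nth_0:
  assumes "u \<in> lists (UNIV <+> {..<r})" "u \<noteq> []" "\<And>j. j < r \<Longrightarrow> S j $ 0 = 0"
  shows "word_value S u $ 0 = 0"
  using assms by (cases u) auto

lemma word_value_agree_below:
  assumes "u \<in> lists (UNIV <+> {..<r})"
    and "\<And>j m. j < r \<Longrightarrow> m < n \<Longrightarrow> S j $ m = S' j $ m" and "m < n"
  shows "word_value S u $ m = word_value S' u $ m"
  using assms(1,3)
proof (induction u arbitrary: m rule: list.induct)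
  case (Cons a u)
  have "case_sum (\<lambda>_. fps_X) S a $ l = case_sum (\<lambda>_. fps_X) S' a $ l" if "l < n" for l
    using Cons.prems(1) assms(2) that by auto
  then show ?case
    using Cons by (auto simp: fps_mult_nth intro!: sum.cong)
qed simp

text \<open>The contraction property behind proper systems: a product of at least two factors
  without constant term has an \<open>n\<close>-th coefficient that involves only coefficients below
  \<open>n\<close> of its factors.\<close>

lemma word_value_agree:
  assumes u: "u \<in> lists (UNIV <+> {..<r})" "u \<noteq> []" "u \<notin> range (\<lambda>j. [Inr j])"
    and agree: "\<And>j m. j < r \<Longrightarrow> m < n \<Longrightarrow> S j $ m = S' j $ m"
    and zero: "\<And>j. j < r \<Longrightarrow> S j $ 0 = 0" "\<And>j. j < r \<Longrightarrow> S' j $ 0 = 0"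
    and "m \<le> n"
  shows "word_value S u $ m = word_value S' u $ m"
proof -
  consider x where "u = [Inl x]" | a b v where "u = a # b # v"
  proof (cases u)
    case (Cons a v)
    with u(3) that show thesis by (cases a; cases v) auto
  qed (use u(2) in simp)
  then show ?thesis
  proof cases
    case 1
    then show ?thesis by simp
  next
    case 2
    let ?f = "case_sum (\<lambda>_. fps_X) S a" and ?f' = "case_sum (\<lambda>_. fps_X) S' a"
    let ?g = "word_value S (b # v)" and ?g' = "word_value S' (b # v)"
    have a: "a \<in> UNIV <+> {..<r}" and v: "b # v \<in> lists (UNIV <+> {..<r})"
      using u(1) 2 by auto
    have f0: "?f $ 0 = 0" "?f' $ 0 = 0" using a zero by auto
    have g0: "?g $ 0 = 0" "?g' $ 0 = 0" using v zero by (intro word_value_nth_0 [of _ r]; simp)+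
    have f: "?f $ l = ?f' $ l" if "l < n" for l using a agree that by auto
    have g: "?g $ l = ?g' $ l" if "l < n" for l
      using v agree that by (rule word_value_agree_below)
    have "?f $ l * ?g $ (m - l) = ?f' $ l * ?g' $ (m - l)" if "l \<le> m" for l
    \<comment> \<open>In the two extreme terms one factor is a constant term, hence zero; all other
      terms use indices below \<open>n\<close>.\<close>
    proof (cases "l = 0 \<or> l = m")
      case True
      with f0 g0 show ?thesis by auto
    next
      case False
      with that \<open>m \<le> n\<close> have "l < n" "m - l < n" by auto
      then show ?thesis by (simp only: f g)
    qed
    then show ?thesis
      unfolding 2 word_value_simps(2) [of _ a] fps_mult_nth by (intro sum.cong) auto
  qed
qed

context
  fixes r :: nat and K :: "nat \<Rightarrow> ('x + nat) list set"
    and c :: "nat \<Rightarrow> ('x + nat) list \<Rightarrow> 'a :: comm_ring_1"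
  assumes proper: "\<And>i. i < r \<Longrightarrow> proper_words r (K i)"
begin

lemma system_rhs_nth_0:
  assumes "i < r" "\<And>j. j < r \<Longrightarrow> S j $ 0 = 0"
  shows "system_rhs K c S i $ 0 = 0"
proof -
  have "word_value S u $ 0 = 0" if "u \<in> K i" for u
    using proper [OF assms(1)] assms(2) that unfolding proper_words_def
    by (intro word_value_nth_0 [of _ r]) auto
  then show ?thesis by (simp add: system_rhs_def fps_sum_nth)
qed

lemma system_rhs_agree:
  assumes "i < r" "\<And>j m. j < r \<Longrightarrow> m < n \<Longrightarrow> S j $ m = S' j $ m"
    and "\<And>j. j < r \<Longrightarrow> S j $ 0 = 0" "\<And>j. j < r \<Longrightarrow> S' j $ 0 = 0" and "m \<le> n"
  shows "system_rhs K c S i $ m = system_rhs K c S' i $ m"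
proof -
  have "word_value S u $ m = word_value S' u $ m" if "u \<in> K i" for u
    using proper [OF assms(1)] that unfolding proper_words_def
    by (intro word_value_agree [OF _ _ _ assms(2-5)]) auto
  then show ?thesis
    by (simp add: system_rhs_def fps_sum_nth)
qed

text \<open>By \<open>system_rhs_agree\<close>, agreement below \<open>n\<close> improves to
  agreement up to \<open>n\<close>, so induction reaches every coefficient.\<close>

lemma system_solution_unique:
  assumes "solves_system r K c S" "solves_system r K c S'" "i < r"
  shows "S i = S' i"
proof -
  have zero: "S j $ 0 = 0" "S' j $ 0 = 0" if "j < r" for j
    using assms(1,2) that unfolding solves_system_def by blast+
  have rhs: "S j = system_rhs K c S j" "S' j = system_rhs K c S' j" if "j < r" for j
    using assms(1,2) that unfolding solves_system_def by blast+
  have "\<forall>j<r. \<forall>m<n. S j $ m = S' j $ m" for n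
  proof (induction n)
    case (Suc n)
    show ?case
    proof (intro allI impI)
      fix j m assume j: "j < r" and m: "m < Suc n"
      have "system_rhs K c S j $ m = system_rhs K c S' j $ m"
        by (rule system_rhs_agree [OF j, of n]) (use Suc m zero in auto)
      then show "S j $ m = S' j $ m" using rhs [OF j] by metis
    qed
  qed simp
  then show ?thesis using assms(3) by (auto intro!: fps_ext)
qed

text \<open>Fixed point iteration from zero: each application of the right-hand side settles one
  more coefficient.\<close>

lemma system_solution_exists: "\<exists>S. solves_system r K c S"
proof -
  define T where "T = (\<lambda>t. (system_rhs K c ^^ t) (\<lambda>_. 0))"
  have T_Suc: "T (Suc t) = system_rhs K c (T t)" for t by (simp add: T_def)
  have zero: "T t j $ 0 = 0" if "j < r" for t j
    using that by (induction t arbitrary: j) (simp_all add: T_Suc system_rhs_nth_0, simp add: T_def)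
  have T_step: "T t j $ m = T (Suc t) j $ m" if "j < r" "m < t" for t j m
    using that
  proof (induction t arbitrary: j m)
    case (Suc t)
    have "system_rhs K c (T t) j $ m = system_rhs K c (T (Suc t)) j $ m"
      by (rule system_rhs_agree [OF Suc.prems(1), of t, OF Suc.IH zero zero])
         (use Suc.prems in simp_all)
    then show ?case by (simp only: T_Suc)
  qed simp
  \<comment> \<open>Coefficient \<open>m\<close> no longer changes from iterate \<open>m + 1\<close>
    on, so it is read off there.\<close>
  define S where "S = (\<lambda>j. Abs_fps (\<lambda>m. T (Suc m) j $ m))"
  have S: "S j $ m = T t j $ m" if "j < r" "m < t" for t j m
  proof -
    have "Suc m \<le> t" using that by simp
    then show ?thesis
    proof (induction t rule: dec_induct)
      case (step t)
      then show ?case using T_step [of j m t] that(1) by simp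
    qed (simp add: S_def)
  qed
  have zero': "S j $ 0 = 0" if "j < r" for j
    using that zero by (simp add: S_def)
  have "S i = system_rhs K c S i" if i: "i < r" for i
  proof (rule fps_ext)
    fix m
    have "system_rhs K c S i $ m = system_rhs K c (T m) i $ m"
      by (rule system_rhs_agree [OF i S zero' zero order.refl])
    then show "S i $ m = system_rhs K c S i $ m" by (simp add: S_def T_Suc)
  qed
  with zero' show ?thesis unfolding solves_system_def by blast
qed

end

section \<open>The length series of a series in non-commuting variables\<close>

text \<open>The image of a series when every variable of \<open>X\<close> is replaced by one
  commuting variable.\<close>

definition length_series :: "'x set \<Rightarrow> 'x nc_series \<Rightarrow> rat fps" where
  "length_series X f = Abs_fps (\<lambda>n. \<Sum>w | set w \<subseteq> X \<and> length w = n. f w)"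

lemma length_series_nth: "length_series X f $ n = (\<Sum>w | set w \<subseteq> X \<and> length w = n. f w)"
  by (simp add: length_series_def)

lemma words_of_length_0: "{w. set w \<subseteq> X \<and> length w = 0} = {[]}"
  by auto

lemma length_series_one: "length_series X nc_one = 1"
proof (rule fps_ext)
  fix n
  have "(\<Sum>w | set w \<subseteq> X \<and> length w = n. nc_one w) = (if n = 0 then 1 else 0)"
  proof (cases "n = 0")
    case True
    then show ?thesis by (simp add: nc_one_def words_of_length_0 del: length_0_conv)
  next
    case False
    then show ?thesis by (auto simp: nc_one_def intro!: sum.neutral)
  qed
  then show "length_series X nc_one $ n = 1 $ n" by (simp add: length_series_nth)
qed

lemma length_series_var:
  assumes "finite X" "x \<in> X"
  shows "length_series X (nc_var x) = fps_X"
proof (rule fps_ext)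
  fix n
  have "(\<Sum>w | set w \<subseteq> X \<and> length w = n. nc_var x w) =
        (\<Sum>w | set w \<subseteq> X \<and> length w = n. if w = [x] then 1 else 0)"
    by (simp add: nc_var_def)
  also have "\<dots> = (if n = 1 then 1 else 0)"
    using assms by (subst sum.delta) (auto simp: finite_lists_length_eq)
  finally show "length_series X (nc_var x) $ n = fps_X $ n"
    by (simp add: length_series_nth)
qed

text \<open>Cutting a word of length \<open>n\<close> after \<open>i\<close> letters is a bijection
  onto pairs of words of lengths \<open>i\<close> and \<open>n - i\<close>; thus
  \<open>nc_mult\<close> becomes the Cauchy product.\<close>

lemma length_series_mult:
  "length_series X (nc_mult f g) = length_series X f * length_series X g"
proof (rule fps_ext)
  fix n
  let ?W = "\<lambda>n. {w. set w \<subseteq> X \<and> length w = n}"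
  have split: "(\<Sum>w\<in>?W n. f (take i w) * g (drop i w)) =
      (\<Sum>(u, v)\<in>?W i \<times> ?W (n - i). f u * g v)" if "i \<le> n" for i
    using that
    by (intro sum.reindex_bij_witness [of _ "\<lambda>(u, v). u @ v" "\<lambda>w. (take i w, drop i w)"])
       (auto dest: in_set_takeD in_set_dropD)
  have "length_series X (nc_mult f g) $ n = (\<Sum>w\<in>?W n. \<Sum>i\<le>n. f (take i w) * g (drop i w))"
    unfolding length_series_nth nc_mult_def by (intro sum.cong) auto
  also have "\<dots> = (\<Sum>i\<le>n. \<Sum>w\<in>?W n. f (take i w) * g (drop i w))" by (rule sum.swap)
  also have "\<dots> = (\<Sum>i\<le>n. (\<Sum>u\<in>?W i. f u) * (\<Sum>v\<in>?W (n - i). g v))"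
    by (intro sum.cong) (simp_all add: split sum_product sum.cartesian_product)
  finally show "length_series X (nc_mult f g) $ n = (length_series X f * length_series X g) $ n"
    by (simp add: length_series_nth fps_mult_nth atLeast0AtMost)
qed

lemma length_series_subst_word:
  assumes "finite X" "u \<in> lists (X <+> UNIV)"
  shows "length_series X (nc_subst_word s u) = word_value (\<lambda>j. length_series X (s j)) u"
  using assms(2)
  by (induction u)
     (auto simp: length_series_one length_series_mult length_series_var [OF assms(1)])

lemma length_series_subst:
  assumes "finite X" "Poly_Mapping.keys p \<subseteq> lists (X <+> UNIV)"
  shows "length_series X (nc_subst s p) = (\<Sum>u\<in>Poly_Mapping.keys p.
           fps_const (Poly_Mapping.lookup p u) * word_value (\<lambda>j. length_series X (s j)) u)"
proof (rule fps_ext)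
  fix n
  have "length_series X (nc_subst s p) $ n = (\<Sum>u\<in>Poly_Mapping.keys p.
      Poly_Mapping.lookup p u * length_series X (nc_subst_word s u) $ n)"
    unfolding length_series_nth nc_subst_def
    by (subst sum.swap) (simp add: sum_distrib_left)
  also have "\<dots> = (\<Sum>u\<in>Poly_Mapping.keys p. Poly_Mapping.lookup p u *
      word_value (\<lambda>j. length_series X (s j)) u $ n)"
    using assms by (intro sum.cong refl) (subst length_series_subst_word, auto)
  finally show "length_series X (nc_subst s p) $ n = (\<Sum>u\<in>Poly_Mapping.keys p.
      fps_const (Poly_Mapping.lookup p u) * word_value (\<lambda>j. length_series X (s j)) u) $ n"
    by (simp add: fps_sum_nth)
qed

text \<open>Identifying the variables respects sums and products and keeps the constant term, so it
  carries solutions to solutions.\<close>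

lemma length_series_solves:
  assumes "finite X" and p: "proper_system X r p" and s: "system_solution X r p s"
  shows "solves_system r (\<lambda>i. Poly_Mapping.keys (p i)) (\<lambda>i. Poly_Mapping.lookup (p i))
           (\<lambda>j. length_series X (s j))"
  unfolding solves_system_def
proof (intro allI impI conjI)
  fix i assume i: "i < r"
  have "s i [] = 0" using s i unfolding system_solution_def by blast
  then show "length_series X (s i) $ 0 = 0"
    by (simp add: length_series_nth words_of_length_0 del: length_0_conv)
  have "lists (X <+> {..<r}) \<subseteq> lists (X <+> UNIV)" by (intro lists_mono) auto
  then have "Poly_Mapping.keys (p i) \<subseteq> lists (X <+> UNIV)"
    using p i unfolding proper_system_def nc_poly_on_def by blast
  from length_series_subst [OF assms(1) this, of s]
  show "length_series X (s i) = system_rhs (\<lambda>i. Poly_Mapping.keys (p i))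
      (\<lambda>i. Poly_Mapping.lookup (p i)) (\<lambda>j. length_series X (s j)) i"
    using s i unfolding system_solution_def system_rhs_def by metis
qed

lemma proper_words_keys:
  assumes p: "proper_system X r p" and i: "i < r"
  shows "proper_words r (Poly_Mapping.keys (p i))"
proof -
  have "lists (X <+> {..<r}) \<subseteq> lists (UNIV <+> {..<r})" by (intro lists_mono) auto
  then have sub: "Poly_Mapping.keys (p i) \<subseteq> lists (UNIV <+> {..<r})"
    using p i unfolding proper_system_def nc_poly_on_def by blast
  have "[] \<notin> Poly_Mapping.keys (p i)"
    using p i unfolding proper_system_def by (simp add: in_keys_iff)
  moreover have "[Inr j] \<notin> Poly_Mapping.keys (p i)" for j
  proof
    assume j: "[Inr j] \<in> Poly_Mapping.keys (p i)"
    with sub have "j < r" by auto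
    with j show False using p i unfolding proper_system_def by (simp add: in_keys_iff)
  qed
  ultimately show ?thesis unfolding proper_words_def using sub by auto
qed

section \<open>Algebraicity of the solutions of proper systems\<close>

text \<open>Algebraicity over the rational functions, with denominators cleared.\<close>

definition algebraic_fps :: "'a :: comm_ring_1 fps \<Rightarrow> bool" where
  "algebraic_fps F \<longleftrightarrow>
     (\<exists>d q. (\<exists>j\<le>d. q j \<noteq> 0) \<and> (\<Sum>j\<le>d. fps_of_poly (q j) * F ^ j) = 0)"

section \<open>Reduction of monomials modulo the perturbed equations\<close>

definition monomial_value :: "nat \<Rightarrow> (nat \<Rightarrow> 'a :: comm_ring_1 fps) \<Rightarrow> (nat \<Rightarrow> nat) \<Rightarrow> 'a fps" where
  "monomial_value r T a = (\<Prod>j<r. T j ^ a j)"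

lemma monomial_value_mult:
  "monomial_value r T a * monomial_value r T b = monomial_value r T (\<lambda>j. a j + b j)"
  by (simp add: monomial_value_def power_add prod.distrib)

lemma monomial_value_single:
  "i < r \<Longrightarrow> monomial_value r T (\<lambda>j. if j = i then n else 0) = T i ^ n"
  unfolding monomial_value_def by (subst prod.remove [of _ i]) auto

text \<open>Commutativity allows sorting the letters. The length of the word then bounds the power
  of \<open>fps_X\<close> and the degree in \<open>T\<close> together.\<close>

lemma word_value_eq_monomial_value:
  assumes "u \<in> lists (UNIV <+> {..<r})"
  shows "\<exists>n b. word_value T u = fps_X ^ n * monomial_value r T b \<and> n + sum b {..<r} = length u"
  using assms
proof (induction u rule: list.induct)
  case Nil
  show ?case by (intro exI [of _ 0] exI [of _ "\<lambda>_. 0"]) (simp add: monomial_value_def)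
next
  case (Cons l u)
  then obtain n b where nb: "word_value T u = fps_X ^ n * monomial_value r T b"
    "n + sum b {..<r} = length u" by auto
  show ?case
  proof (cases l)
    case (Inl x)
    with nb show ?thesis by (intro exI [of _ "Suc n"] exI [of _ b]) (simp add: mult_ac)
  next
    case (Inr j)
    with Cons.prems have j: "j < r" by auto
    let ?e = "\<lambda>i. if i = j then 1 else 0 :: nat"
    have "word_value T (l # u) = fps_X ^ n * (T j ^ 1 * monomial_value r T b)"
      using Inr nb by (simp add: mult_ac)
    also have "\<dots> = fps_X ^ n * monomial_value r T (\<lambda>i. ?e i + b i)"
      by (simp only: monomial_value_single [OF j, symmetric] monomial_value_mult)
    finally have "word_value T (l # u) = fps_X ^ n * monomial_value r T (\<lambda>i. ?e i + b i)" .
    moreover have "n + (\<Sum>i<r. ?e i + b i) = length (l # u)"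
      using nb j by (simp add: sum.distrib)
    ultimately show ?thesis by blast
  qed
qed

text \<open>Membership up to a power of \<open>e\<close>; this replaces division by
  \<open>e\<close>, which is impossible in the coefficient ring.\<close>

definition saturated_xspan :: "'a :: comm_ring_1 \<Rightarrow> 'a fps set \<Rightarrow> nat \<Rightarrow> 'a fps set" where
  "saturated_xspan e G m = {y. \<exists>n. fps_const (e ^ n) * y \<in> xspan G m}"

lemma saturated_xspanI: "fps_const (e ^ n) * y \<in> xspan G m \<Longrightarrow> y \<in> saturated_xspan e G m"
  by (auto simp: saturated_xspan_def)

lemma xspan_const_power_le:
  assumes "fps_const (e ^ n) * y \<in> xspan G m" "n \<le> n'"
  shows "fps_const (e ^ n') * y \<in> xspan G m"
proof -
  have "e ^ n' = e ^ (n' - n) * e ^ n" using assms(2) by (simp flip: power_add)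
  then have "fps_const (e ^ n') * y = fps_const (e ^ (n' - n)) * (fps_const (e ^ n) * y)"
    by (simp only: fps_const_mult [symmetric] mult.assoc)
  with assms(1) show ?thesis by (simp only: xspan_scale)
qed

lemma saturated_xspan_zero: "0 \<in> saturated_xspan e G m"
  by (auto simp: saturated_xspan_def xspan_zero)

lemma saturated_xspan_scale:
  assumes "y \<in> saturated_xspan e G m"
  shows "fps_const c * y \<in> saturated_xspan e G m"
proof -
  obtain n where "fps_const (e ^ n) * y \<in> xspan G m"
    using assms by (auto simp: saturated_xspan_def)
  then have "fps_const c * (fps_const (e ^ n) * y) \<in> xspan G m" by (rule xspan_scale)
  then show ?thesis by (intro saturated_xspanI [of e n]) (simp only: mult.left_commute)
qed

lemma saturated_xspan_add:
  assumes "x \<in> saturated_xspan e G m" "y \<in> saturated_xspan e G m"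
  shows "x + y \<in> saturated_xspan e G m"
proof -
  obtain n n' where "fps_const (e ^ n) * x \<in> xspan G m" "fps_const (e ^ n') * y \<in> xspan G m"
    using assms by (auto simp: saturated_xspan_def)
  then have "fps_const (e ^ (n + n')) * x \<in> xspan G m" "fps_const (e ^ (n + n')) * y \<in> xspan G m"
    by (auto elim: xspan_const_power_le)
  then have "fps_const (e ^ (n + n')) * (x + y) \<in> xspan G m"
    unfolding distrib_left by (rule xspan_add)
  then show ?thesis by (rule saturated_xspanI)
qed

lemma saturated_xspan_diff:
  assumes "x \<in> saturated_xspan e G m" "y \<in> saturated_xspan e G m"
  shows "x - y \<in> saturated_xspan e G m"
  using saturated_xspan_add [OF assms(1) saturated_xspan_scale [OF assms(2), of "-1"]]
  by (simp flip: fps_const_neg)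

lemma saturated_xspan_sum:
  assumes "\<And>i. i \<in> I \<Longrightarrow> f i \<in> saturated_xspan e G m"
  shows "sum f I \<in> saturated_xspan e G m"
  using assms
  by (induction I rule: infinite_finite_induct)
     (auto intro: saturated_xspan_zero saturated_xspan_add)

lemma saturated_xspan_X_power_mult:
  assumes "y \<in> saturated_xspan e G m" "i + m \<le> n"
  shows "fps_X ^ i * y \<in> saturated_xspan e G n"
proof -
  obtain l where "fps_const (e ^ l) * y \<in> xspan G m"
    using assms by (auto simp: saturated_xspan_def)
  then have "fps_X ^ i * (fps_const (e ^ l) * y) \<in> xspan G n"
    using assms(2) by (intro xspan_mono [OF order.refl _ xspan_X_power_mult])
  then show ?thesis by (intro saturated_xspanI [of e l]) (simp only: mult.left_commute)
qed

lemma saturated_xspan_cancel: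
  "fps_const e * y \<in> saturated_xspan e G m \<Longrightarrow> y \<in> saturated_xspan e G m"
  unfolding saturated_xspan_def mem_Collect_eq mult.assoc [symmetric] fps_const_mult
  by (metis power_Suc2)

context
  fixes r D :: nat and K :: "nat \<Rightarrow> ('x + nat) list set"
    and c :: "nat \<Rightarrow> ('x + nat) list \<Rightarrow> 'a :: comm_ring_1" and T :: "nat \<Rightarrow> 'a fps" and e :: 'a
  assumes D: "D \<ge> 2"
    and K: "\<And>i. i < r \<Longrightarrow> K i \<subseteq> lists (UNIV <+> {..<r})"
    and len: "\<And>i u. i < r \<Longrightarrow> u \<in> K i \<Longrightarrow> length u < D"
    and T: "\<And>i. i < r \<Longrightarrow> fps_const e * T i ^ D = T i - system_rhs K c T i"
begin

text \<open>The equations rewrite \<open>e\<close> times \<open>T i ^ D\<close> by terms of total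
  degree below \<open>D\<close>. Each rewriting lowers the total degree of a monomial and creates
  fewer than \<open>D\<close> powers of \<open>fps_X\<close>, whence the bound
  \<open>D * sum a {..<r}\<close>.\<close>

lemma monomial_value_in_saturated_xspan:
  "monomial_value r T a \<in>
     saturated_xspan e (monomial_value r T ` ({..<r} \<rightarrow>\<^sub>E {..<D})) (D * sum a {..<r})"
proof (induction "sum a {..<r}" arbitrary: a rule: less_induct)
  case less
  let ?Sat = "saturated_xspan e (monomial_value r T ` ({..<r} \<rightarrow>\<^sub>E {..<D}))"
  show ?case
  proof (cases "\<forall>i<r. a i < D")
    case True
    have "monomial_value r T a = monomial_value r T (restrict a {..<r})"
      by (simp add: monomial_value_def)
    moreover have "restrict a {..<r} \<in> {..<r} \<rightarrow>\<^sub>E {..<D}" using True by auto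
    ultimately have "monomial_value r T a \<in>
        xspan (monomial_value r T ` ({..<r} \<rightarrow>\<^sub>E {..<D})) (D * sum a {..<r})"
      by (intro xspan_superset) auto
    then show ?thesis by (intro saturated_xspanI [of e 0]) simp
  next
    case False
    then obtain i where i: "i < r" "a i \<ge> D" by auto
    define b where "b = a(i := a i - D)"
    let ?single = "\<lambda>n j. if j = i then n else 0 :: nat"
    have a: "a = (\<lambda>j. ?single D j + b j)" using i by (auto simp: b_def)
    have wa: "sum a {..<r} = D + sum b {..<r}"
      unfolding a using i by (simp add: sum.distrib)
    have IH: "fps_X ^ n * monomial_value r T (\<lambda>j. b' j + b j) \<in> ?Sat (D * sum a {..<r})"
      if "n + sum b' {..<r} < D" for n b'
    proof -
      have w: "(\<Sum>j<r. b' j + b j) = sum b' {..<r} + sum b {..<r}" by (simp add: sum.distrib)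
      then have less': "(\<Sum>j<r. b' j + b j) < sum a {..<r}" using wa that by simp
      \<comment> \<open>The degree drops by at least one, which frees \<open>D\<close> powers of
        \<open>fps_X\<close>; the rewriting uses only \<open>n < D\<close> of them.\<close>
      then have "D * Suc (\<Sum>j<r. b' j + b j) \<le> D * sum a {..<r}"
        by (intro mult_le_mono2) simp
      then have "n + D * (\<Sum>j<r. b' j + b j) \<le> D * sum a {..<r}" using that by simp
      from saturated_xspan_X_power_mult [OF less [OF less'] this] show ?thesis .
    qed
    have "fps_const e * monomial_value r T a =
        (fps_const e * T i ^ D) * monomial_value r T b"
      unfolding a monomial_value_mult [symmetric] monomial_value_single [OF i(1)]
      by (simp only: mult.assoc)
    also have "\<dots> = T i ^ 1 * monomial_value r T b - system_rhs K c T i * monomial_value r T b"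
      by (simp add: T [OF i(1)] algebra_simps)
    also have "\<dots> = monomial_value r T (\<lambda>j. ?single 1 j + b j) -
        (\<Sum>u\<in>K i. fps_const (c i u) * (word_value T u * monomial_value r T b))"
      by (simp only: monomial_value_single [OF i(1), symmetric] monomial_value_mult
          system_rhs_def sum_distrib_right mult.assoc)
    also have "\<dots> \<in> ?Sat (D * sum a {..<r})"
    proof (intro saturated_xspan_diff saturated_xspan_sum saturated_xspan_scale)
      show "monomial_value r T (\<lambda>j. ?single 1 j + b j) \<in> ?Sat (D * sum a {..<r})"
        using IH [of 0 "?single 1"] D i(1) by simp
    next
      fix u assume u: "u \<in> K i"
      then obtain n b' where nb: "word_value T u = fps_X ^ n * monomial_value r T b'"
        "n + sum b' {..<r} = length u"
        using word_value_eq_monomial_value [of u r T] K [OF i(1)] by blast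
      then show "word_value T u * monomial_value r T b \<in> ?Sat (D * sum a {..<r})"
        using IH [of n b'] len [OF i(1) u] by (simp only: mult.assoc monomial_value_mult)
    qed
    finally show ?thesis by (rule saturated_xspan_cancel)
  qed
qed

end

text \<open>The products of powers of \<open>fps_X\<close> and \<open>T l\<close> in a large box
  outnumber the generators of the span into which they reduce.\<close>

lemma power_dependence_over_parameter:
  fixes c :: "nat \<Rightarrow> ('x + nat) list \<Rightarrow> 'a :: idom"
  assumes D: "D \<ge> 2"
    and K: "\<And>i. i < r \<Longrightarrow> K i \<subseteq> lists (UNIV <+> {..<r})"
    and len: "\<And>i u. i < r \<Longrightarrow> u \<in> K i \<Longrightarrow> length u < D"
    and T: "\<And>i. i < r \<Longrightarrow> fps_const e * T i ^ D = T i - system_rhs K c T i"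
    and e: "e \<noteq> 0" and l: "l < r"
  shows "\<exists>A B x. (\<exists>p\<in>{..A} \<times> {..B}. x p \<noteq> 0) \<and>
           (\<Sum>p\<in>{..A} \<times> {..B}. fps_const (x p) * (fps_X ^ fst p * T l ^ snd p)) = 0"
proof -
  \<comment> \<open>With \<open>A = D * B\<close> the reduction of \<open>T l ^ B\<close> at most
    doubles the degree bound \<open>A\<close>. There are then at most
    \<open>(2 * A + 1) * D ^ r\<close> generators, and \<open>B = 2 * D ^ r\<close> makes
    \<open>(A + 1) * (B + 1)\<close> larger.\<close>
  define B where "B = 2 * D ^ r"
  define A where "A = D * B"
  define G where "G = monomial_value r T ` ({..<r} \<rightarrow>\<^sub>E {..<D})"
  let ?I = "{..A} \<times> {..B}"
  have fin: "finite G" unfolding G_def by (intro finite_imageI finite_PiE) auto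
  have "card G \<le> card ({..<r} \<rightarrow>\<^sub>E {..<D})"
    unfolding G_def by (intro card_image_le finite_PiE) auto
  also have "\<dots> = D ^ r" by (simp add: card_PiE)
  finally have "(A + D * B + 1) * card G \<le> (2 * A + 1) * D ^ r"
    unfolding A_def by (intro mult_le_mono) auto
  also have "\<dots> < (A + 1) * (B + 1)" by (simp add: B_def algebra_simps)
  also have "\<dots> = card ?I" by (simp add: card_cartesian_product)
  finally have card: "(A + D * B + 1) * card G < card ?I" .
  have "fps_X ^ fst p * T l ^ snd p \<in> saturated_xspan e G (A + D * B)" if "p \<in> ?I" for p
  proof -
    have "T l ^ snd p \<in> saturated_xspan e G (D * snd p)"
      using monomial_value_in_saturated_xspan [OF D K len T, where a = "\<lambda>j. if j = l then snd p else 0"] l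
      by (simp add: G_def monomial_value_single)
    then show ?thesis
      by (rule saturated_xspan_X_power_mult) (use that in \<open>auto intro: add_le_mono\<close>)
  qed
  then have "\<exists>n. fps_const (e ^ n) * (fps_X ^ fst p * T l ^ snd p) \<in> xspan G (A + D * B)"
    if "p \<in> ?I" for p
    using that unfolding saturated_xspan_def by blast
  then obtain n where n:
    "\<And>p. p \<in> ?I \<Longrightarrow> fps_const (e ^ n p) * (fps_X ^ fst p * T l ^ snd p) \<in> xspan G (A + D * B)"
    by metis
  \<comment> \<open>One power of \<open>e\<close> that works for all products at once, so that it
    can be factored out of the relation.\<close>
  define N where "N = Max (n ` ?I)"
  have N: "fps_const (e ^ N) * (fps_X ^ fst p * T l ^ snd p) \<in> xspan G (A + D * B)"
    if "p \<in> ?I" for p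
    using n [OF that] by (rule xspan_const_power_le) (use that in \<open>auto simp: N_def\<close>)
  have "finite ?I" by simp
  have "\<exists>x. (\<exists>p\<in>?I. x p \<noteq> 0) \<and>
      (\<Sum>p\<in>?I. fps_const (x p) * (fps_const (e ^ N) * (fps_X ^ fst p * T l ^ snd p))) = 0"
    by (rule xspan_dependent [OF fin \<open>finite ?I\<close> card N])
  then obtain x where x: "\<exists>p\<in>?I. x p \<noteq> 0"
    "(\<Sum>p\<in>?I. fps_const (x p) * (fps_const (e ^ N) * (fps_X ^ fst p * T l ^ snd p))) = 0"
    by (elim exE conjE)
  have "fps_const (e ^ N) * (\<Sum>p\<in>?I. fps_const (x p) * (fps_X ^ fst p * T l ^ snd p)) = 0"
    using x(2) by (simp only: sum_distrib_left mult.left_commute)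
  with e have "(\<Sum>p\<in>?I. fps_const (x p) * (fps_X ^ fst p * T l ^ snd p)) = 0" by simp
  with x(1) show ?thesis by (intro exI conjI)
qed

section \<open>Specialisation of the parameter at zero\<close>

text \<open>If all coefficients vanish at zero, the parameter \<open>[:0, 1:]\<close> divides the
  whole relation and can be cancelled. This lowers the degree of the fixed nonzero coefficient
  \<open>x p\<close>, so it must stop.\<close>

lemma relation_cancel_parameter:
  fixes v :: "'i \<Rightarrow> 'a :: idom poly fps"
  assumes "\<exists>i\<in>I. x i \<noteq> 0" "(\<Sum>i\<in>I. fps_const (x i) * v i) = 0"
  shows "\<exists>x. (\<exists>i\<in>I. poly (x i) 0 \<noteq> 0) \<and> (\<Sum>i\<in>I. fps_const (x i) * v i) = 0"
proof -
  obtain p where p: "p \<in> I" "x p \<noteq> 0" using assms(1) by blast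
  show ?thesis
    using p(2) assms(2)
  proof (induction "degree (x p)" arbitrary: x rule: less_induct)
    case less
    show ?case
    proof (cases "\<exists>i\<in>I. poly (x i) 0 \<noteq> 0")
      case False
      then have "\<forall>i\<in>I. \<exists>y. x i = [:0, 1:] * y"
        by (auto simp: poly_eq_0_iff_dvd elim!: dvdE)
      then obtain y where y: "\<And>i. i \<in> I \<Longrightarrow> x i = [:0, 1:] * y i" by metis
      have "y p \<noteq> 0" using y [OF p(1)] less.prems by auto
      then have "degree (y p) < degree (x p)" by (simp add: y [OF p(1)])
      moreover have "(\<Sum>i\<in>I. fps_const (x i) * v i) =
          fps_const [:0, 1:] * (\<Sum>i\<in>I. fps_const (y i) * v i)"
        unfolding sum_distrib_left
        by (intro sum.cong refl) (simp only: y fps_const_mult [symmetric] mult.assoc)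
      with less.prems(2) have "(\<Sum>i\<in>I. fps_const (y i) * v i) = 0" by simp
      ultimately show ?thesis using \<open>y p \<noteq> 0\<close> by (intro less.hyps)
    next
      case True
      with less.prems(2) show ?thesis by blast
    qed
  qed
qed

text \<open>The coefficients are polynomials in the parameter \<epsilon>; the series variable is
  untouched. This is the ring homomorphism that sets \<epsilon> to zero.\<close>

definition fps_at_0 :: "'a :: comm_ring_1 poly fps \<Rightarrow> 'a fps" where
  "fps_at_0 f = Abs_fps (\<lambda>n. poly (f $ n) 0)"

lemma fps_at_0_nth: "fps_at_0 f $ n = poly (f $ n) 0"
  by (simp add: fps_at_0_def)

lemma fps_at_0_hom [simp]:
  "fps_at_0 0 = 0" "fps_at_0 1 = 1" "fps_at_0 fps_X = fps_X"
  "fps_at_0 (fps_const c) = fps_const (poly c 0)"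
  "fps_at_0 (f + g) = fps_at_0 f + fps_at_0 g"
  "fps_at_0 (f * g) = fps_at_0 f * fps_at_0 g"
  by (simp_all add: fps_eq_iff fps_at_0_nth fps_mult_nth poly_sum)

lemma fps_at_0_power: "fps_at_0 (f ^ n) = fps_at_0 f ^ n"
  by (induction n) simp_all

lemma fps_at_0_sum: "fps_at_0 (\<Sum>i\<in>I. f i) = (\<Sum>i\<in>I. fps_at_0 (f i))"
  by (induction I rule: infinite_finite_induct) simp_all

lemma fps_at_0_word_value: "fps_at_0 (word_value T u) = word_value (\<lambda>j. fps_at_0 (T j)) u"
  by (induction u) (auto split: sum.split)

lemma relation_imp_algebraic_fps:
  assumes "p \<in> {..A} \<times> {..B}" "x p \<noteq> 0"
    and "(\<Sum>p\<in>{..A} \<times> {..B}. fps_const (x p) * (fps_X ^ fst p * F ^ snd p)) = 0"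
  shows "algebraic_fps F"
proof -
  define q where "q = (\<lambda>j. \<Sum>i\<le>A. monom (x (i, j)) i)"
  have "(\<Sum>j\<le>B. fps_of_poly (q j) * F ^ j) =
      (\<Sum>j\<le>B. \<Sum>i\<le>A. fps_const (x (i, j)) * (fps_X ^ i * F ^ j))"
    by (simp add: q_def fps_of_poly_sum fps_of_poly_monom sum_distrib_right mult.assoc)
  also have "\<dots> = (\<Sum>i\<le>A. \<Sum>j\<le>B. fps_const (x (i, j)) * (fps_X ^ i * F ^ j))"
    by (rule sum.swap)
  also have "\<dots> = 0" using assms(3) by (simp add: sum.cartesian_product case_prod_unfold)
  finally have "(\<Sum>j\<le>B. fps_of_poly (q j) * F ^ j) = 0" .
  moreover have "coeff (q (snd p)) (fst p) = x p"
    using assms(1) by (auto simp: q_def coeff_sum)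
  with assms(2) have "q (snd p) \<noteq> 0" by auto
  moreover have "snd p \<le> B" using assms(1) by auto
  ultimately show ?thesis unfolding algebraic_fps_def by blast
qed

text \<open>
  Adding \<open>\<epsilon> y\<^sub>i\<^sup>D\<close> to the \<open>i\<close>-th right-hand side, with \<open>D\<close> above all degrees, makes the quotient of the
  polynomial ring by the equations finite over the field of rational functions in \<open>z\<close> and \<open>\<epsilon>\<close>,
  which need not be the case for the system itself. Relations between powers of the perturbed
  solution therefore follow by counting dimensions; dividing such a relation by the right power of
  \<open>\<epsilon>\<close> before setting \<open>\<epsilon> = 0\<close> keeps it nontrivial.
\<close>

lemma system_solution_algebraic:
  fixes c :: "nat \<Rightarrow> ('x + nat) list \<Rightarrow> 'a :: idom"
  assumes proper: "\<And>i. i < r \<Longrightarrow> proper_words r (K i)"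
    and fin: "\<And>i. i < r \<Longrightarrow> finite (K i)"
    and S: "solves_system r K c S" and l: "l < r"
  shows "algebraic_fps (S l)"
proof -
  have "finite (length ` (\<Union>i<r. K i))" using fin by auto
  then obtain D' where D': "\<forall>n\<in>length ` (\<Union>i<r. K i). n < D'"
    using finite_nat_set_iff_bounded by blast
  \<comment> \<open>\<open>D\<close> exceeds all word lengths, so the new word \<open>w i\<close> is
    not in \<open>K i\<close>; being at least 2, it also keeps the perturbed system proper.\<close>
  define D where "D = D' + 2"
  have D: "D \<ge> 2" by (simp add: D_def)
  have len: "length u < D" if "i < r" "u \<in> K i" for i u
    using D' that by (fastforce simp: D_def)
  define e :: "'a poly" where "e = [:0, 1:]"
  define w :: "nat \<Rightarrow> ('x + nat) list" where "w = (\<lambda>i. replicate D (Inr i))"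
  define K' where "K' = (\<lambda>i. insert (w i) (K i))"
  define c' where "c' = (\<lambda>i u. if u = w i then e else [:c i u:])"
  define cp where "cp = (\<lambda>i u. [:c i u:])"
  have w: "w i \<notin> K i" if "i < r" for i using len [OF that, of "w i"] by (auto simp: w_def)
  have proper': "proper_words r (K' i)" if "i < r" for i
  proof -
    have "w i \<noteq> [Inr j]" for j using D by (auto simp: w_def dest: arg_cong [of _ _ length])
    then show ?thesis
      using proper [OF that] that D by (auto simp: proper_words_def K'_def w_def)
  qed
  obtain T where T: "solves_system r K' c' T"
    using system_solution_exists [of r K' c', OF proper'] by blast
  have T0: "T i $ 0 = 0" and T_eq: "T i = system_rhs K' c' T i" if "i < r" for i
    using T that unfolding solves_system_def by blast+
  have rhs: "system_rhs K' c' T i = fps_const e * T i ^ D + system_rhs K cp T i" if i: "i < r" for i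
  proof -
    have "word_value T (w i) = T i ^ D"
      unfolding w_def word_value_def by (simp add: prod_list_replicate)
    moreover have "(\<Sum>u\<in>K i. fps_const (c' i u) * word_value T u) = system_rhs K cp T i"
      unfolding system_rhs_def cp_def using w [OF i] by (intro sum.cong) (auto simp: c'_def)
    ultimately show ?thesis
      using fin [OF i] w [OF i] by (simp add: system_rhs_def K'_def) (simp add: c'_def)
  qed
  have reduce: "fps_const e * T i ^ D = T i - system_rhs K cp T i" if "i < r" for i
    unfolding eq_diff_eq by (rule sym [OF trans [OF T_eq [OF that] rhs [OF that]]])
  have K: "K i \<subseteq> lists (UNIV <+> {..<r})" if "i < r" for i
    using proper [OF that] by (auto simp: proper_words_def)
  have e: "e \<noteq> 0" by (simp add: e_def)
  have "\<exists>A B x. (\<exists>p\<in>{..A} \<times> {..B}. x p \<noteq> 0) \<and>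
      (\<Sum>p\<in>{..A} \<times> {..B}. fps_const (x p) * (fps_X ^ fst p * T l ^ snd p)) = 0"
    by (rule power_dependence_over_parameter
          [where r = r and K = K and c = cp and T = T and e = e and D = D])
       (fact D K len reduce e l)+
  then obtain A B x where "\<exists>p\<in>{..A} \<times> {..B}. x p \<noteq> 0"
    "(\<Sum>p\<in>{..A} \<times> {..B}. fps_const (x p) * (fps_X ^ fst p * T l ^ snd p)) = 0"
    by (elim exE conjE)
  from relation_cancel_parameter [OF this]
  obtain x where x: "\<exists>p\<in>{..A} \<times> {..B}. poly (x p) 0 \<noteq> 0"
    "(\<Sum>p\<in>{..A} \<times> {..B}. fps_const (x p) * (fps_X ^ fst p * T l ^ snd p)) = 0"
    by (elim exE conjE)
  \<comment> \<open>At \<epsilon> = 0 the perturbed solution solves the original system, hence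
    equals \<open>S\<close> by uniqueness.\<close>
  define S' where "S' = (\<lambda>j. fps_at_0 (T j))"
  have "S' i = system_rhs K c S' i" if "i < r" for i
  proof -
    have "S' i = fps_at_0 (fps_const e * T i ^ D + system_rhs K cp T i)"
      unfolding S'_def by (rule arg_cong [OF trans [OF T_eq [OF that] rhs [OF that]]])
    also have "\<dots> = system_rhs K c S' i"
      by (simp add: e_def cp_def system_rhs_def fps_at_0_sum fps_at_0_word_value S'_def)
    finally show ?thesis .
  qed
  moreover have "S' i $ 0 = 0" if "i < r" for i
    using T0 [OF that] by (simp add: S'_def fps_at_0_nth)
  ultimately have "solves_system r K c S'"
    unfolding solves_system_def by blast
  then have S_l: "fps_at_0 (T l) = S l"
    using system_solution_unique [OF proper _ S l, of S'] by (simp add: S'_def)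
  have "(\<Sum>p\<in>{..A} \<times> {..B}. fps_const (poly (x p) 0) * (fps_X ^ fst p * S l ^ snd p)) = 0"
    using arg_cong [OF x(2), of fps_at_0] by (simp add: fps_at_0_sum fps_at_0_power S_l)
  moreover obtain p where "p \<in> {..A} \<times> {..B}" "poly (x p) 0 \<noteq> 0" using x(1) by blast
  ultimately show ?thesis by (rule relation_imp_algebraic_fps [rotated 2])
qed

section \<open>Algebraic power series satisfy linear differential equations\<close>

lemma fps_XD_mult: "fps_XD (f * g) = fps_XD f * g + f * fps_XD (g :: 'a :: comm_ring_1 fps)"
  by (simp add: fps_XD_def algebra_simps)

lemma fps_XD_sum: "fps_XD (\<Sum>i\<in>I. f i) = (\<Sum>i\<in>I. fps_XD (f i :: 'a :: comm_ring_1 fps))"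
  by (simp add: fps_eq_iff fps_sum_nth sum_distrib_left)

lemma fps_XD_const: "fps_XD (fps_const c) = 0" "fps_XD (0 :: 'a :: comm_ring_1 fps) = 0"
  "fps_XD (1 :: 'a :: comm_ring_1 fps) = 0"
  by (simp_all add: fps_XD_def)

text \<open>The extra factor \<open>f\<close> avoids the truncated exponent
  \<open>n - 1\<close>.\<close>

lemma mult_fps_XD_power:
  "f * fps_XD (f ^ n) = of_nat n * (f ^ n * fps_XD (f :: 'a :: comm_ring_1 fps))"
proof (induction n)
  case (Suc n)
  have "f * fps_XD (f ^ Suc n) = f ^ Suc n * fps_XD f + f * (f * fps_XD (f ^ n))"
    by (simp add: fps_XD_mult algebra_simps)
  then show ?case unfolding Suc by (simp add: algebra_simps)
qed (simp add: fps_XD_const)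

lemma fps_XD_power:
  "fps_XD (f ^ n) = of_nat n * f ^ (n - 1) * fps_XD (f :: 'a :: comm_ring_1 fps)"
  by (cases n) (simp_all add: fps_XD_const fps_XD_mult mult_fps_XD_power algebra_simps)

lemma fps_XD_X_power: "fps_XD (fps_X ^ i) = of_nat i * (fps_X ^ i :: 'a :: comm_ring_1 fps)"
  by (simp add: fps_eq_iff fps_X_power_nth flip: fps_of_nat)

lemma fps_XD_of_poly: "fps_XD (fps_of_poly q) = fps_of_poly ([:0, 1:] * pderiv q)"
  by (simp only: fps_XD_def fps_of_poly_mult fps_of_poly_pderiv fps_of_poly_fps_X o_apply)

section \<open>Filtration by degree in the variable and in the series\<close>

text \<open>The degree bound \<open>n\<close> applies separately to \<open>fps_X\<close> and to
  \<open>F\<close>.\<close>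

definition power_xspan :: "'a :: comm_ring_1 fps \<Rightarrow> nat \<Rightarrow> 'a fps set" where
  "power_xspan F n = xspan ((\<lambda>j. F ^ j) ` {..n}) n"

lemma power_xspan_mono: "m \<le> n \<Longrightarrow> x \<in> power_xspan F m \<Longrightarrow> x \<in> power_xspan F n"
  unfolding power_xspan_def by (rule xspan_mono) auto

lemma power_xspan_base: "i \<le> n \<Longrightarrow> j \<le> n \<Longrightarrow> fps_X ^ i * F ^ j \<in> power_xspan F n"
  unfolding power_xspan_def by (rule xspan_base) auto

lemma power_xspan_add:
  "x \<in> power_xspan F n \<Longrightarrow> y \<in> power_xspan F n \<Longrightarrow> x + y \<in> power_xspan F n"
  and power_xspan_diff:
  "x \<in> power_xspan F n \<Longrightarrow> y \<in> power_xspan F n \<Longrightarrow> x - y \<in> power_xspan F n"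
  and power_xspan_scale: "x \<in> power_xspan F n \<Longrightarrow> fps_const c * x \<in> power_xspan F n"
  unfolding power_xspan_def by (rule xspan_add xspan_diff xspan_scale; assumption)+

lemma power_xspan_of_nat_mult: "x \<in> power_xspan F n \<Longrightarrow> of_nat m * x \<in> power_xspan F n"
  using power_xspan_scale [of x F n "of_nat m"] by (simp add: fps_of_nat)

lemma power_xspan_mult:
  assumes "x \<in> power_xspan F m" "y \<in> power_xspan F n"
  shows "x * y \<in> power_xspan F (m + n)"
proof -
  have *: "y * F ^ j \<in> xspan ((\<lambda>j. F ^ j) ` {..m + n}) n" if "j \<le> m" for j
    using assms(2) unfolding power_xspan_def
  proof (induction rule: xspan_induct)
    case zero
    then show ?case by (simp add: xspan_zero)
  next
    case (step c i g z)
    then obtain l where l: "l \<le> n" "g = F ^ l" by auto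
    have "fps_const c * (fps_X ^ i * F ^ (l + j)) + z * F ^ j \<in> xspan ((\<lambda>j. F ^ j) ` {..m + n}) n"
      using step l that by (intro xspan_add xspan_scale xspan_base) auto
    then show ?case by (simp add: l power_add algebra_simps)
  qed
  have "y * x \<in> xspan ((\<lambda>j. F ^ j) ` {..m + n}) (m + n)"
    by (rule xspan_mult [OF assms(1) [unfolded power_xspan_def]]) (use * in auto)
  then show ?thesis by (simp add: power_xspan_def mult.commute)
qed

lemma power_xspan_power: "x \<in> power_xspan F m \<Longrightarrow> x ^ n \<in> power_xspan F (m * n)"
proof (induction n)
  case 0
  show ?case using power_xspan_base [of 0 0 0 F] by simp
next
  case (Suc n)
  then show ?case using power_xspan_mult [of x F m "x ^ n" "m * n"] by simp
qed

lemma power_xspan_Union_sum: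
  assumes "\<And>j. j \<in> I \<Longrightarrow> \<exists>n. f j \<in> power_xspan F n"
  shows "\<exists>n. sum f I \<in> power_xspan F n"
  using assms
proof (induction I rule: infinite_finite_induct)
  case (insert j I)
  then obtain m n where "f j \<in> power_xspan F m" "sum f I \<in> power_xspan F n" by blast
  then have "f j + sum f I \<in> power_xspan F (m + n)"
    by (intro power_xspan_add) (auto elim: power_xspan_mono [rotated])
  with insert show ?case by auto
qed (auto simp: power_xspan_def xspan_zero)

lemma poly_combination_in_power_xspan:
  "\<exists>n. (\<Sum>j\<in>I. fps_of_poly (q j) * F ^ j) \<in> power_xspan F n"
proof (rule power_xspan_Union_sum)
  fix j
  have "F ^ j \<in> xspan ((\<lambda>j. F ^ j) ` {..j}) 0" by (intro xspan_superset) auto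
  then have "fps_of_poly (q j) * F ^ j \<in> xspan ((\<lambda>j. F ^ j) ` {..j}) (degree (q j) + 0)"
    by (rule xspan_poly_mult)
  then have "fps_of_poly (q j) * F ^ j \<in> power_xspan F (degree (q j) + j)"
    unfolding power_xspan_def by (rule xspan_mono [rotated 2]) auto
  then show "\<exists>n. fps_of_poly (q j) * F ^ j \<in> power_xspan F n" by blast
qed

text \<open>Here \<open>d\<close> acts as a denominator of \<open>fps_XD F\<close>: by the product
  rule one factor \<open>d\<close> clears the denominator of the derivative of any polynomial in
  \<open>fps_X\<close> and \<open>F\<close>.\<close>

lemma power_xspan_fps_XD:
  assumes x: "x \<in> power_xspan F n"
    and d: "d \<in> power_xspan F c" "d * fps_XD F \<in> power_xspan F c"
  shows "d * fps_XD x \<in> power_xspan F (n + c)"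
  using x unfolding power_xspan_def [of F n]
proof (induction rule: xspan_induct)
  case zero
  show ?case by (simp add: fps_XD_const power_xspan_def xspan_zero)
next
  case (step k i g y)
  then obtain j where j: "j \<le> n" "g = F ^ j" by auto
  have "fps_X ^ i * F ^ j * d \<in> power_xspan F (n + c)"
    "fps_X ^ i * F ^ (j - 1) * (d * fps_XD F) \<in> power_xspan F (n + c)"
    using step j by (intro power_xspan_mult power_xspan_base d; simp)+
  then have "fps_const k * (of_nat i * (fps_X ^ i * F ^ j * d) +
      of_nat j * (fps_X ^ i * F ^ (j - 1) * (d * fps_XD F))) + d * fps_XD y \<in> power_xspan F (n + c)"
    using step by (intro power_xspan_add power_xspan_scale power_xspan_of_nat_mult)
  also have "fps_const k * (of_nat i * (fps_X ^ i * F ^ j * d) +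
      of_nat j * (fps_X ^ i * F ^ (j - 1) * (d * fps_XD F))) + d * fps_XD y =
      d * fps_XD (fps_const k * (fps_X ^ i * g) + y)"
    by (simp add: j fps_XD_const fps_XD_mult fps_XD_X_power fps_XD_power [of F] algebra_simps)
  finally show ?case .
qed

lemma power_xspan_iterated_fps_XD:
  assumes d: "d \<in> power_xspan F c" "d * fps_XD F \<in> power_xspan F c"
  shows "d ^ (2 * j) * (fps_XD ^^ j) F \<in> power_xspan F (1 + 2 * c * j)"
proof (induction j)
  case 0
  show ?case using power_xspan_base [of 0 1 1 F] by simp
next
  case (Suc j)
  let ?n = "1 + 2 * c * j"
  define t where "t = d ^ (2 * j) * (fps_XD ^^ j) F"
  have t: "t \<in> power_xspan F ?n" using Suc by (simp add: t_def)
  \<comment> \<open>Differentiating \<open>t\<close> also hits the prefactor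
    \<open>d ^ (2 * j)\<close>. Subtracting that contribution isolates the next derivative;
    multiplying by two factors \<open>d\<close> keeps both terms polynomial.\<close>
  have "d * (d * fps_XD t) - of_nat (2 * j) * (t * (d * fps_XD d)) \<in> power_xspan F (c + c + ?n)"
  proof (intro power_xspan_diff power_xspan_of_nat_mult)
    show "d * (d * fps_XD t) \<in> power_xspan F (c + c + ?n)"
      using power_xspan_mult [OF d(1) power_xspan_fps_XD [OF t d]] by (simp add: ac_simps)
    show "t * (d * fps_XD d) \<in> power_xspan F (c + c + ?n)"
      using power_xspan_mult [OF t power_xspan_fps_XD [OF d(1) d]] by (simp add: ac_simps)
  qed
  also have "d * (d * fps_XD t) = d * (d * fps_XD (d ^ (2 * j))) * (fps_XD ^^ j) F +
      d ^ (2 * j + 2) * (fps_XD ^^ Suc j) F"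
    by (simp add: t_def fps_XD_mult algebra_simps)
  also have "d * (d * fps_XD (d ^ (2 * j))) * (fps_XD ^^ j) F =
      of_nat (2 * j) * (t * (d * fps_XD d))"
    unfolding mult_fps_XD_power t_def by (simp add: mult_ac)
  finally show ?case by (simp add: algebra_simps)
qed

text \<open>The relation expresses \<open>fps_of_poly (q d) * F ^ d\<close> by lower powers of
  \<open>F\<close>. Spending one leading coefficient per power of \<open>F\<close> keeps the degree
  linear in \<open>n\<close>, which the later dimension count requires.\<close>

lemma reduce_powers:
  fixes F :: "'a :: idom fps"
  assumes rel: "(\<Sum>j\<le>d. fps_of_poly (q j) * F ^ j) = 0" and "d > 0"
    and h: "\<And>j. j \<le> d \<Longrightarrow> degree (q j) \<le> h" and x: "x \<in> power_xspan F n"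
  shows "fps_of_poly (q d) ^ n * x \<in> xspan ((\<lambda>j. F ^ j) ` {..<d}) (n + h * n)"
proof -
  let ?Z = "xspan ((\<lambda>j. F ^ j) ` {..<d})" and ?l = "fps_of_poly (q d)"
  have low: "fps_of_poly (q i) * F ^ j \<in> ?Z h" if "i \<le> d" "j < d" for i j
  proof -
    have "F ^ j \<in> ?Z 0" using that by (intro xspan_superset) auto
    from xspan_poly_mult [OF this, of "q i"] show ?thesis
      by (rule xspan_mono [rotated 2]) (use h [OF that(1)] in auto)
  qed
  have "?l * F ^ d + (\<Sum>j<d. fps_of_poly (q j) * F ^ j) = 0"
    using rel by (simp add: lessThan_Suc_atMost [symmetric] add.commute)
  then have top: "?l * F ^ d = - (\<Sum>j<d. fps_of_poly (q j) * F ^ j)"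
    by (simp add: eq_neg_iff_add_eq_0)
  have step: "?l * F * F ^ j \<in> ?Z h" if "j < d" for j
  proof (cases "Suc j = d")
    case True
    then have "?l * F * F ^ j = ?l * F ^ d" by (auto simp: mult_ac)
    also have "\<dots> \<in> ?Z h" unfolding top by (intro xspan_neg xspan_sum low) auto
    finally show ?thesis .
  next
    case False
    with that low [of d "Suc j"] show ?thesis by (simp add: mult_ac)
  qed
  have pow: "?l ^ m * F ^ m \<in> ?Z (h * m)" for m
  proof (induction m)
    case 0
    show ?case using \<open>d > 0\<close> by (intro xspan_superset image_eqI [of _ _ 0]) auto
  next
    case (Suc m)
    have "?l * F * (?l ^ m * F ^ m) \<in> ?Z (h * m + h)"
      by (rule xspan_mult [OF Suc]) (use step in auto)
    then show ?case by (simp add: algebra_simps)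
  qed
  \<comment> \<open>The \<open>n - j\<close> surplus leading coefficients are absorbed as a
    polynomial of degree at most \<open>h * (n - j)\<close>.\<close>
  have "?l ^ n * F ^ j \<in> ?Z (h * n)" if "j \<le> n" for j
  proof -
    have "fps_of_poly (q d ^ (n - j)) * (?l ^ j * F ^ j) \<in> ?Z (degree (q d ^ (n - j)) + h * j)"
      by (rule xspan_poly_mult [OF pow])
    moreover have "degree (q d ^ (n - j)) + h * j \<le> h * n"
    proof -
      have "degree (q d ^ (n - j)) \<le> h * (n - j)"
        using degree_power_le [of "q d" "n - j"] mult_le_mono1 [OF h [OF order.refl], of "n - j"]
        by (rule order.trans)
      moreover have "h * (n - j) + h * j = h * n"
        using that by (simp add: add_mult_distrib2 [symmetric])
      ultimately show ?thesis by simp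
    qed
    ultimately have "fps_of_poly (q d ^ (n - j)) * (?l ^ j * F ^ j) \<in> ?Z (h * n)"
      by (blast intro: xspan_mono)
    moreover have "fps_of_poly (q d ^ (n - j)) * (?l ^ j * F ^ j) = ?l ^ n * F ^ j"
      using that by (simp add: fps_of_poly_power mult.assoc [symmetric] flip: power_add)
    ultimately show ?thesis by simp
  qed
  then show ?thesis by (intro xspan_mult [OF x [unfolded power_xspan_def]]) auto
qed

section \<open>The minimal relation and the differential equation\<close>

text \<open>In a relation of least degree the derivative with respect to \<open>F\<close> has
  smaller degree, and characteristic zero keeps its top coefficient nonzero; by minimality it cannot
  vanish.\<close>

lemma algebraic_fps_minimal_relation:
  fixes F :: "'a :: {idom, ring_char_0} fps"
  assumes "algebraic_fps F"
  obtains d q where "d > 0" "q d \<noteq> 0" "(\<Sum>j\<le>d. fps_of_poly (q j) * F ^ j) = 0"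
    "(\<Sum>j<d. fps_of_poly (smult (of_nat (Suc j)) (q (Suc j))) * F ^ j) \<noteq> 0"
proof -
  define R where "R = (\<lambda>d. \<exists>q. (\<exists>j\<le>d. q j \<noteq> 0) \<and> (\<Sum>j\<le>d. fps_of_poly (q j) * F ^ j) = 0)"
  define d where "d = (LEAST d. R d)"
  have "\<exists>d. R d" using assms unfolding algebraic_fps_def R_def .
  then have "R d" unfolding d_def by (rule LeastI_ex)
  then obtain q where "(\<exists>j\<le>d. q j \<noteq> 0) \<and> (\<Sum>j\<le>d. fps_of_poly (q j) * F ^ j) = 0"
    unfolding R_def by (rule exE)
  then have q: "\<exists>j\<le>d. q j \<noteq> 0" "(\<Sum>j\<le>d. fps_of_poly (q j) * F ^ j) = 0"
    by simp_all
  have min: "\<not> R d'" if "d' < d" for d' using that unfolding d_def by (rule not_less_Least)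
  have "d > 0"
  proof (rule ccontr)
    assume "\<not> d > 0"
    with q have "q 0 \<noteq> 0" "fps_of_poly (q 0) = fps_of_poly 0" by auto
    then show False by (simp only: fps_of_poly_eq_iff)
  qed
  then obtain d' where d': "d = Suc d'" by (auto simp: gr0_conv_Suc)
  have top: "q d \<noteq> 0"
  proof
    assume "q d = 0"
    with q d' have "(\<exists>j\<le>d'. q j \<noteq> 0) \<and> (\<Sum>j\<le>d'. fps_of_poly (q j) * F ^ j) = 0"
      by (auto simp: le_Suc_eq)
    then have "R d'" unfolding R_def by (rule exI [of _ q])
    with min d' show False by simp
  qed
  have "(\<Sum>j<d. fps_of_poly (smult (of_nat (Suc j)) (q (Suc j))) * F ^ j) \<noteq> 0"
  proof
    assume "(\<Sum>j<d. fps_of_poly (smult (of_nat (Suc j)) (q (Suc j))) * F ^ j) = 0"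
    moreover have "smult (of_nat (Suc d')) (q (Suc d')) \<noteq> 0"
      using top d' by (simp del: of_nat_Suc)
    ultimately have "(\<exists>j\<le>d'. smult (of_nat (Suc j)) (q (Suc j)) \<noteq> 0) \<and>
        (\<Sum>j\<le>d'. fps_of_poly (smult (of_nat (Suc j)) (q (Suc j))) * F ^ j) = 0"
      unfolding d' lessThan_Suc_atMost by blast
    then have "R d'"
      unfolding R_def by (rule exI [of _ "\<lambda>j. smult (of_nat (Suc j)) (q (Suc j))"])
    with min d' show False by simp
  qed
  with that \<open>d > 0\<close> top q(2) show thesis by blast
qed

text \<open>
  With \<open>\<delta>\<close> the \<open>y\<close>-derivative of the minimal relation at \<open>F\<close> and \<open>\<theta> = z d/dz\<close>, the series
  \<open>\<delta>\<^sup>2\<^sup>j \<theta>\<^sup>j F\<close> is a polynomial in \<open>z\<close> and \<open>F\<close> of degree linear in \<open>j\<close>. Up to a common factor the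
  polynomials of degree at most \<open>n\<close> in \<open>z\<close> and \<open>F\<close> span a space of dimension only \<open>O(n)\<close>, so there
  are more products \<open>z\<^sup>i \<theta>\<^sup>j F\<close> than dimensions.
\<close>

lemma algebraic_fps_imp_differential_equation:
  fixes F :: "'a :: {idom, ring_char_0} fps"
  assumes "algebraic_fps F"
  shows "\<exists>I J x. (\<exists>p\<in>{..I} \<times> {..J}. x p \<noteq> 0) \<and>
    (\<Sum>p\<in>{..I} \<times> {..J}. fps_const (x p) * (fps_X ^ fst p * (fps_XD ^^ snd p) F)) = 0"
proof -
  obtain d q where d: "d > 0" and top: "q d \<noteq> 0"
    and rel: "(\<Sum>j\<le>d. fps_of_poly (q j) * F ^ j) = 0"
    and der: "(\<Sum>j<d. fps_of_poly (smult (of_nat (Suc j)) (q (Suc j))) * F ^ j) \<noteq> 0"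
    using assms by (rule algebraic_fps_minimal_relation)
  define \<delta> where "\<delta> = (\<Sum>j<d. fps_of_poly (smult (of_nat (Suc j)) (q (Suc j))) * F ^ j)"
  \<comment> \<open>Applying \<open>fps_XD\<close> to the relation shows that
    \<open>\<delta> * fps_XD F\<close> is a polynomial in \<open>fps_X\<close> and
    \<open>F\<close>.\<close>
  have "0 = fps_XD (\<Sum>j\<le>d. fps_of_poly (q j) * F ^ j)"
    unfolding rel by (simp add: fps_XD_const)
  also have "\<dots> = (\<Sum>j\<le>d. fps_of_poly ([:0, 1:] * pderiv (q j)) * F ^ j) +
      (\<Sum>j\<le>d. fps_of_poly (q j) * (of_nat j * F ^ (j - 1) * fps_XD F))"
    by (simp only: fps_XD_sum fps_XD_mult fps_XD_of_poly fps_XD_power sum.distrib)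
  also have "(\<Sum>j\<le>d. fps_of_poly (q j) * (of_nat j * F ^ (j - 1) * fps_XD F)) = \<delta> * fps_XD F"
  proof -
    have "(\<Sum>j\<le>d. fps_of_poly (q j) * (of_nat j * F ^ (j - 1) * fps_XD F)) =
        (\<Sum>j<d. fps_of_poly (q (Suc j)) * (of_nat (Suc j) * F ^ j * fps_XD F))"
      by (simp add: lessThan_Suc_atMost [symmetric] sum.lessThan_Suc_shift del: sum.lessThan_Suc)
    also have "\<dots> = \<delta> * fps_XD F"
      by (simp add: \<delta>_def sum_distrib_left sum_distrib_right fps_of_poly_smult fps_of_nat mult_ac
          del: of_nat_Suc)
    finally show ?thesis .
  qed
  finally have "\<delta> * fps_XD F = (\<Sum>j\<le>d. fps_of_poly (- ([:0, 1:] * pderiv (q j))) * F ^ j)"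
    by (simp only: fps_of_poly_uminus mult_minus_left sum_negf eq_neg_iff_add_eq_0 add.commute)
  then obtain c1 where "\<delta> * fps_XD F \<in> power_xspan F c1"
    using poly_combination_in_power_xspan [of "\<lambda>j. - ([:0, 1:] * pderiv (q j))" F "{..d}"] by auto
  moreover obtain c2 where "\<delta> \<in> power_xspan F c2"
    using poly_combination_in_power_xspan [of "\<lambda>j. smult (of_nat (Suc j)) (q (Suc j))" F "{..<d}"]
    unfolding \<delta>_def by blast
  moreover define c where "c = c1 + c2"
  ultimately have \<delta>: "\<delta> \<in> power_xspan F c" "\<delta> * fps_XD F \<in> power_xspan F c"
    by (auto elim: power_xspan_mono [rotated])
  define h where "h = (\<Sum>j\<le>d. degree (q j))"
  have h: "degree (q j) \<le> h" if "j \<le> d" for j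
    unfolding h_def using that by (intro member_le_sum) auto
  \<comment> \<open>The dimension grows like \<open>M * n\<close>. Since \<open>I\<close> exceeds
    \<open>2 * c * J\<close>, the degree \<open>n\<close> is about \<open>2 * I\<close> at most, so
    \<open>J = 2 * M\<close> gives enough products.\<close>
  define M where "M = (1 + h) * d"
  define J where "J = 2 * M"
  define I where "I = 2 * c * J + d"
  define n where "n = I + (1 + 2 * c * J)"
  define G where "G = (\<lambda>j. F ^ j) ` {..<d}"
  let ?I = "{..I} \<times> {..J}" and ?l = "fps_of_poly (q d)"
  have fin: "finite G" "finite ?I" by (auto simp: G_def)
  have "card G \<le> d" unfolding G_def using card_image_le [of "{..<d}" "\<lambda>j. F ^ j"] by simp
  then have "(n + h * n + 1) * card G \<le> (n + h * n + 1) * d" by (rule mult_le_mono2)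
  also have "\<dots> = M * (I + 1) + M * (2 * c * J) + d" by (simp add: M_def n_def algebra_simps)
  also have "\<dots> < M * (I + 1) + M * (I + 1) + (I + 1)"
  proof -
    have "M * (2 * c * J) \<le> M * (I + 1)" by (intro mult_le_mono2) (simp add: I_def)
    moreover have "d < I + 1" by (simp add: I_def)
    ultimately show ?thesis by linarith
  qed
  also have "\<dots> = card ?I" by (simp add: card_cartesian_product J_def algebra_simps)
  finally have card: "(n + h * n + 1) * card G < card ?I" .
  \<comment> \<open>All products get the same nonzero factor, which is cancelled at the end. A
    product with the \<open>j\<close>-th derivative needs only \<open>2 * j\<close> factors
    \<delta>; the others pad the exponent to \<open>2 * J\<close>.\<close>
  have v: "?l ^ n * (\<delta> ^ (2 * J) * (fps_X ^ fst p * (fps_XD ^^ snd p) F)) \<in> xspan G (n + h * n)"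
    if "p \<in> ?I" for p
  proof -
    from that obtain i j where p: "p = (i, j)" "i \<le> I" "j \<le> J" by (cases p) auto
    have "fps_X ^ i \<in> power_xspan F i" using power_xspan_base [of i i 0 F] by simp
    from power_xspan_mult [OF this power_xspan_mult
        [OF power_xspan_power [OF \<delta>(1), of "2 * (J - j)"]
            power_xspan_iterated_fps_XD [OF \<delta>, of j]]]
    have "fps_X ^ i * (\<delta> ^ (2 * (J - j)) * (\<delta> ^ (2 * j) * (fps_XD ^^ j) F)) \<in> power_xspan F n"
    proof (rule power_xspan_mono [rotated])
      have "c * (2 * (J - j)) + 2 * c * j = 2 * c * J"
        using p(3) by (simp add: diff_mult_distrib2)
      with p(2) show "i + (c * (2 * (J - j)) + (1 + 2 * c * j)) \<le> n" by (simp add: n_def)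
    qed
    also have "fps_X ^ i * (\<delta> ^ (2 * (J - j)) * (\<delta> ^ (2 * j) * (fps_XD ^^ j) F)) =
        \<delta> ^ (2 * (J - j) + 2 * j) * (fps_X ^ i * (fps_XD ^^ j) F)"
      by (simp add: power_add mult_ac)
    also have "2 * (J - j) + 2 * j = 2 * J" using p(3) by simp
    finally show ?thesis unfolding G_def p(1) fst_conv snd_conv by (intro reduce_powers rel d h)
  qed
  have "\<exists>x. (\<exists>p\<in>?I. x p \<noteq> 0) \<and> (\<Sum>p\<in>?I. fps_const (x p) *
      (?l ^ n * (\<delta> ^ (2 * J) * (fps_X ^ fst p * (fps_XD ^^ snd p) F)))) = 0"
    by (rule xspan_dependent [OF fin card v])
  then obtain x where x: "\<exists>p\<in>?I. x p \<noteq> 0" "(\<Sum>p\<in>?I. fps_const (x p) *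
      (?l ^ n * (\<delta> ^ (2 * J) * (fps_X ^ fst p * (fps_XD ^^ snd p) F)))) = 0"
    by (elim exE conjE)
  have "?l ^ n * \<delta> ^ (2 * J) *
      (\<Sum>p\<in>?I. fps_const (x p) * (fps_X ^ fst p * (fps_XD ^^ snd p) F)) = 0"
    using x(2) by (simp only: sum_distrib_left mult_ac)
  moreover have "?l \<noteq> 0" using top fps_of_poly_eq_iff [of "q d" 0] by simp
  moreover have "\<delta> \<noteq> 0" using der unfolding \<delta>_def .
  ultimately have "(\<Sum>p\<in>?I. fps_const (x p) * (fps_X ^ fst p * (fps_XD ^^ snd p) F)) = 0"
    by simp
  with x(1) show ?thesis by (intro exI conjI)
qed

text \<open>Multiplying the relation by the \<open>d\<close>-th power of \<open>H\<close> lets each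
  \<open>F ^ j\<close> take its \<open>j\<close> factors; the rest joins the coefficients.\<close>

lemma algebraic_fps_poly_mult:
  fixes F :: "'a :: idom fps"
  assumes "algebraic_fps F" "H \<noteq> 0"
  shows "algebraic_fps (fps_of_poly H * F)"
proof -
  obtain d q j where q: "j \<le> d" "q j \<noteq> 0" "(\<Sum>j\<le>d. fps_of_poly (q j) * F ^ j) = 0"
    using assms(1) unfolding algebraic_fps_def by (elim exE conjE)
  have "(\<Sum>j\<le>d. fps_of_poly (H ^ (d - j) * q j) * (fps_of_poly H * F) ^ j) =
      (\<Sum>j\<le>d. fps_of_poly H ^ d * (fps_of_poly (q j) * F ^ j))"
  proof (intro sum.cong refl)
    fix j assume "j \<in> {..d}"
    then have "fps_of_poly H ^ d = fps_of_poly H ^ (d - j) * fps_of_poly H ^ j"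
      by (simp flip: power_add)
    then show "fps_of_poly (H ^ (d - j) * q j) * (fps_of_poly H * F) ^ j =
        fps_of_poly H ^ d * (fps_of_poly (q j) * F ^ j)"
      by (simp add: fps_of_poly_mult fps_of_poly_power power_mult_distrib mult_ac)
  qed
  also have "\<dots> = 0" by (simp only: sum_distrib_left [symmetric] q(3) mult_zero_right)
  finally have "(\<Sum>j\<le>d. fps_of_poly (H ^ (d - j) * q j) * (fps_of_poly H * F) ^ j) = 0" .
  moreover have "\<exists>j\<le>d. H ^ (d - j) * q j \<noteq> 0" using q(1,2) assms(2) by auto
  ultimately show ?thesis
    unfolding algebraic_fps_def
    by (rule_tac x = d in exI, rule_tac x = "\<lambda>j. H ^ (d - j) * q j" in exI) (rule conjI)
qed

section \<open>Bounded integer coefficients\<close>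

lemma common_denominator:
  assumes "finite S"
  shows "\<exists>D :: int. D > 0 \<and> (\<forall>x\<in>S. rat_of_int D * x \<in> \<int>)"
  using assms
proof (induction S rule: finite_induct)
  case empty
  show ?case by (intro exI [of _ 1]) simp
next
  case (insert y S)
  then obtain D :: int where D: "D > 0" "\<forall>x\<in>S. rat_of_int D * x \<in> \<int>" by blast
  obtain a b where ab: "quotient_of y = (a, b)" by (cases "quotient_of y")
  have b: "b > 0" using quotient_of_denom_pos [OF ab] .
  have "rat_of_int (D * b) * x \<in> \<int>" if "x \<in> insert y S" for x
  proof (cases "x = y")
    case True
    have "y = rat_of_int a / rat_of_int b" using quotient_of_div [OF ab] .
    then have "rat_of_int (D * b) * y = rat_of_int (D * a)" using b by simp
    with True show ?thesis by (simp only: Ints_of_int)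
  next
    case False
    have "rat_of_int (D * b) * x = rat_of_int b * (rat_of_int D * x)" by simp
    also have "\<dots> \<in> \<int>" using False that D(2) by (auto intro: Ints_mult [OF Ints_of_int])
    finally show ?thesis .
  qed
  with D(1) b show ?case by (intro exI [of _ "D * b"]) auto
qed

text \<open>The error made when a recurrence divided by \<open>real n ^ m\<close> is replaced by its
  leading part.\<close>

lemma tendsto_power_quotient:
  assumes "j \<le> m"
  shows "(\<lambda>n. (if j = m then 1 else 0) - real (n - i) ^ j / real n ^ m) \<longlonglongrightarrow> 0"
proof -
  have "(\<lambda>n. (1 - real i * inverse (real n)) ^ j * inverse (real n) ^ (m - j))
      \<longlonglongrightarrow> (1 - real i * 0) ^ j * 0 ^ (m - j)"
    by (intro tendsto_intros LIMSEQ_inverse_real_of_nat tendsto_inverse_0_at_top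
        filterlim_real_sequentially)
  moreover have "(1 - real i * 0) ^ j * 0 ^ (m - j) = (if j = m then 1 else 0 :: real)"
    using assms by (auto simp: power_0_left)
  moreover have "eventually (\<lambda>n. (1 - real i * inverse (real n)) ^ j * inverse (real n) ^ (m - j) =
      real (n - i) ^ j / real n ^ m) sequentially"
    using eventually_gt_at_top [of i]
  proof eventually_elim
    case (elim n)
    then have "1 - real i * inverse (real n) = real (n - i) / real n"
      by (simp add: field_simps of_nat_diff)
    moreover have "real n ^ m = real n ^ j * real n ^ (m - j)"
      using assms by (simp flip: power_add)
    ultimately show ?case using elim by (simp add: power_divide field_simps)
  qed
  ultimately have "(\<lambda>n. real (n - i) ^ j / real n ^ m) \<longlonglongrightarrow> (if j = m then 1 else 0)"
    by (simp add: filterlim_cong)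
  then have "(\<lambda>n. (if j = m then 1 else 0) - real (n - i) ^ j / real n ^ m)
      \<longlonglongrightarrow> (if j = m then 1 else 0) - (if j = m then 1 else 0)"
    by (intro tendsto_diff tendsto_const)
  then show ?thesis by simp
qed

lemma fps_X_power_mult_XD_nth:
  "i \<le> n \<Longrightarrow> (fps_X ^ i * (fps_XD ^^ j) F) $ n = of_nat (n - i) ^ j * F $ (n - i)"
  for F :: "'a :: comm_ring_1 fps"
  by (simp add: fps_X_power_mult_nth fps_mult_fps_XD_shift)

text \<open>Dividing the recurrence by \<open>real n ^ m\<close> and using boundedness, its leading
  part tends to zero. Its values have a common denominator, so they vanish eventually, and
  \<open>fps_of_poly C * F\<close> is a polynomial.\<close>

lemma algebraic_bounded_integers_imp_rational:
  fixes F :: "rat fps"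
  assumes "algebraic_fps F"
    and int: "\<And>n. n \<ge> N \<Longrightarrow> F $ n \<in> \<int>" and bounded: "\<And>n. n \<ge> N \<Longrightarrow> \<bar>F $ n\<bar> \<le> b"
  shows "\<exists>C P. C \<noteq> 0 \<and> fps_of_poly C * F = fps_of_poly P"
proof -
  obtain I J x where x: "\<exists>p\<in>{..I} \<times> {..J}. x p \<noteq> 0"
    "(\<Sum>p\<in>{..I} \<times> {..J}. fps_const (x p) * (fps_X ^ fst p * (fps_XD ^^ snd p) F)) = 0"
    using algebraic_fps_imp_differential_equation [OF assms(1)] by (elim exE conjE)
  define S where "S = {j. j \<le> J \<and> (\<exists>i\<le>I. x (i, j) \<noteq> 0)}"
  have S: "finite S" "S \<noteq> {}" using x(1) by (auto simp: S_def)
  \<comment> \<open>The highest power of the index that occurs in the recurrence; \<open>C\<close>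
    below collects its coefficients.\<close>
  define m where "m = Max S"
  have "m \<in> S" using S by (simp add: m_def)
  then have m: "m \<le> J" "\<exists>i\<le>I. x (i, m) \<noteq> 0" by (auto simp: S_def)
  have above: "x (i, j) = 0" if "i \<le> I" "j \<le> J" "m < j" for i j
  proof (rule ccontr)
    assume "x (i, j) \<noteq> 0"
    with that have "j \<in> S" by (auto simp: S_def)
    with S(1) have "j \<le> m" unfolding m_def by (rule Max_ge)
    with that show False by simp
  qed
  define C where "C = (\<Sum>i\<le>I. monom (x (i, m)) i)"
  have "coeff C i = x (i, m)" if "i \<le> I" for i using that by (simp add: C_def coeff_sum)
  with m(2) have C: "C \<noteq> 0" by auto
  have C_nth: "(fps_of_poly C * F) $ n = (\<Sum>i\<le>I. x (i, m) * F $ (n - i))" if "n \<ge> I" for n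
  proof -
    have "fps_of_poly C * F = (\<Sum>i\<le>I. fps_const (x (i, m)) * (fps_X ^ i * F))"
      by (simp add: C_def fps_of_poly_sum fps_of_poly_monom sum_distrib_right mult.assoc)
    with that show ?thesis by (simp add: fps_sum_nth fps_X_power_mult_nth)
  qed
  have rel: "(\<Sum>i\<le>I. \<Sum>j\<le>m. x (i, j) * (of_nat (n - i) ^ j * F $ (n - i))) = 0" if "n \<ge> I" for n
  proof -
    have "0 = (\<Sum>p\<in>{..I} \<times> {..J}. fps_const (x p) * (fps_X ^ fst p * (fps_XD ^^ snd p) F)) $ n"
      unfolding x(2) by simp
    also have "\<dots> = (\<Sum>p\<in>{..I} \<times> {..J}. x p * (of_nat (n - fst p) ^ snd p * F $ (n - fst p)))"
      unfolding fps_sum_nth fps_mult_left_const_nth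
      by (intro sum.cong refl, subst fps_X_power_mult_XD_nth) (use that in auto)
    also have "\<dots> = (\<Sum>i\<le>I. \<Sum>j\<le>J. x (i, j) * (of_nat (n - i) ^ j * F $ (n - i)))"
      by (simp add: sum.cartesian_product case_prod_unfold)
    also have "\<dots> = (\<Sum>i\<le>I. \<Sum>j\<le>m. x (i, j) * (of_nat (n - i) ^ j * F $ (n - i)))"
      using m(1) above by (intro sum.cong refl sum.mono_neutral_right) auto
    finally show ?thesis by simp
  qed
  define u where "u = (\<lambda>n. (fps_of_poly C * F) $ n)"
  define f where "f = (\<lambda>n. real_of_rat (F $ n))"
  define g where "g = (\<lambda>i j n. (if j = m then 1 else 0) - real (n - i) ^ j / real n ^ m)"
  have u_eq: "real_of_rat (u n) =
      (\<Sum>i\<le>I. \<Sum>j\<le>m. real_of_rat (x (i, j)) * (g i j n * f (n - i)))" if "n \<ge> I" for n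
  proof -
    have "real_of_rat (u n) = (\<Sum>i\<le>I. real_of_rat (x (i, m)) * f (n - i))"
      by (simp add: u_def C_nth [OF that] f_def of_rat_sum of_rat_mult)
    also have "\<dots> = (\<Sum>i\<le>I. \<Sum>j\<le>m. real_of_rat (x (i, j)) * ((if j = m then 1 else 0) * f (n - i)))"
      by (intro sum.cong refl) (simp add: if_distrib if_distribR sum.delta' cong: if_cong)
    finally have 1: "real_of_rat (u n) = \<dots>" .
    \<comment> \<open>The full recurrence, divided by \<open>real n ^ m\<close>, is subtracted from
      \<open>u n\<close>; this turns the weights into \<open>g i j n\<close>.\<close>
    have "0 = real_of_rat (\<Sum>i\<le>I. \<Sum>j\<le>m. x (i, j) * (of_nat (n - i) ^ j * F $ (n - i))) / real n ^ m"
      by (simp add: rel [OF that])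
    also have "\<dots> = (\<Sum>i\<le>I. \<Sum>j\<le>m.
        real_of_rat (x (i, j)) * (real (n - i) ^ j / real n ^ m * f (n - i)))"
      by (simp add: of_rat_sum of_rat_mult of_rat_power f_def sum_divide_distrib)
    finally show ?thesis
      unfolding 1 by (simp add: g_def left_diff_distrib right_diff_distrib sum_subtractf)
  qed
  have "(\<lambda>n. \<Sum>i\<le>I. \<Sum>j\<le>m. real_of_rat (x (i, j)) * (g i j n * f (n - i))) \<longlonglongrightarrow>
      (\<Sum>i\<le>I. \<Sum>j\<le>m. real_of_rat (x (i, j)) * 0)"
  proof (intro tendsto_sum tendsto_mult tendsto_const)
    fix i j assume "j \<in> {..m}"
    then have "g i j \<longlonglongrightarrow> 0" unfolding g_def by (intro tendsto_power_quotient) simp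
    moreover have "eventually (\<lambda>n. norm (g i j n * f (n - i)) \<le> norm (g i j n) * real_of_rat b)
        sequentially"
      using eventually_ge_at_top [of "N + i"]
    proof eventually_elim
      case (elim n)
      then have "\<bar>f (n - i)\<bar> \<le> real_of_rat b"
        using bounded [of "n - i"]
        by (simp add: f_def abs_le_iff of_rat_less_eq flip: of_rat_minus)
      then show ?case by (simp add: abs_mult mult_left_mono)
    qed
    ultimately show "(\<lambda>n. g i j n * f (n - i)) \<longlonglongrightarrow> 0" by (rule tendsto_0_le)
  qed
  moreover have "eventually (\<lambda>n. (\<Sum>i\<le>I. \<Sum>j\<le>m. real_of_rat (x (i, j)) * (g i j n * f (n - i))) =
      real_of_rat (u n)) sequentially"
    using eventually_ge_at_top [of I] by eventually_elim (simp add: u_eq)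
  ultimately have u_lim: "(\<lambda>n. real_of_rat (u n)) \<longlonglongrightarrow> 0"
    by (simp add: filterlim_cong)
  obtain D :: int where D: "D > 0" "\<forall>y\<in>(\<lambda>i. x (i, m)) ` {..I}. rat_of_int D * y \<in> \<int>"
    using common_denominator [of "(\<lambda>i. x (i, m)) ` {..I}"] by auto
  have u_int: "rat_of_int D * u n \<in> \<int>" if "n \<ge> N + I" for n
  proof -
    have "rat_of_int D * u n = (\<Sum>i\<le>I. (rat_of_int D * x (i, m)) * F $ (n - i))"
      using that by (simp add: u_def C_nth sum_distrib_left mult.assoc)
    also have "\<dots> \<in> \<int>" using D(2) that by (intro Ints_sum Ints_mult [OF _ int]) auto
    finally show ?thesis .
  qed
  have "eventually (\<lambda>n. dist (real_of_rat (u n)) 0 < 1 / real_of_int D) sequentially"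
    using u_lim D(1) by (intro tendstoD) auto
  then obtain N' where N': "\<And>n. n \<ge> N' \<Longrightarrow> \<bar>real_of_rat (u n)\<bar> < 1 / real_of_int D"
    unfolding eventually_sequentially by (auto simp: dist_real_def)
  \<comment> \<open>\<open>D * u n\<close> is an integer of absolute value below 1.\<close>
  have u_0: "u n = 0" if n: "n \<ge> N + I + N'" for n
  proof -
    obtain k where k: "rat_of_int D * u n = rat_of_int k"
      using u_int [of n] n by (auto elim: Ints_cases)
    then have "real_of_int D * real_of_rat (u n) = real_of_int k"
      by (metis of_rat_mult of_rat_of_int_eq)
    moreover have "\<bar>real_of_int D * real_of_rat (u n)\<bar> < 1"
      using N' [of n] n D(1) by (simp add: abs_mult field_simps)
    ultimately have "\<bar>real_of_int k\<bar> < 1" by simp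
    then have "k = 0" by (simp flip: of_int_abs)
    with k D(1) show ?thesis by simp
  qed
  have "fps_of_poly (truncate_fps (N + I + N') (fps_of_poly C * F)) = fps_of_poly C * F"
    using u_0 by (auto simp: fps_eq_iff u_def)
  with C show ?thesis by metis
qed

section \<open>Values of rational power series at rational points\<close>

text \<open>The Cauchy product gives \<open>C(x)\<close> times the value equal to
  \<open>P(x)\<close>. If \<open>C(x)\<close> is zero, so is \<open>P(x)\<close>, and the common
  linear factor is cancelled before the induction on the degree.\<close>

lemma rational_fps_value_rational:
  fixes B :: "rat fps" and x :: rat
  assumes "C \<noteq> 0" "fps_of_poly C * B = fps_of_poly P"
    and summable: "summable (\<lambda>n. norm (real_of_rat (B $ n * x ^ n)))"
  shows "suminf (\<lambda>n. real_of_rat (B $ n * x ^ n)) \<in> \<rat>"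
  using assms(1,2)
proof (induction "degree C" arbitrary: C P rule: less_induct)
  case less
  let ?\<beta> = "suminf (\<lambda>n. real_of_rat (B $ n * x ^ n))"
  have fin: "(\<lambda>n. real_of_rat (coeff Q n * x ^ n)) sums real_of_rat (poly Q x)" for Q
    unfolding poly_altdef of_rat_sum
    by (rule sums_finite) (auto simp: coeff_eq_0)
  have "summable (\<lambda>n. norm (real_of_rat (coeff C n * x ^ n)))"
    by (rule summable_finite [of "{..degree C}"]) (auto simp: coeff_eq_0)
  from Cauchy_product_sums [OF this summable]
  have "(\<lambda>n. \<Sum>i\<le>n. real_of_rat (coeff C i * x ^ i) * real_of_rat (B $ (n - i) * x ^ (n - i)))
      sums (real_of_rat (poly C x) * ?\<beta>)"
    using sums_unique [OF fin [of C]] by simp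
  moreover have "(\<Sum>i\<le>n. real_of_rat (coeff C i * x ^ i) * real_of_rat (B $ (n - i) * x ^ (n - i))) =
      real_of_rat (coeff P n * x ^ n)" for n
  proof -
    have "coeff P n = (\<Sum>i\<le>n. coeff C i * B $ (n - i))"
      using arg_cong [OF less.prems(2), of "\<lambda>f. f $ n"]
      by (simp add: fps_mult_nth atLeast0AtMost)
    then have "coeff P n * x ^ n = (\<Sum>i\<le>n. coeff C i * B $ (n - i) * (x ^ i * x ^ (n - i)))"
      by (simp add: sum_distrib_right flip: power_add)
    then show ?thesis by (simp add: of_rat_sum of_rat_mult mult_ac)
  qed
  ultimately have eq: "real_of_rat (poly C x) * ?\<beta> = real_of_rat (poly P x)"
    using sums_unique2 [OF _ fin [of P]] by simp
  show ?case
  proof (cases "poly C x = 0")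
    case False
    then have "?\<beta> = real_of_rat (poly P x) / real_of_rat (poly C x)"
      using eq by (simp add: field_simps)
    then show ?thesis by simp
  next
    case True
    with eq have "poly P x = 0" by simp
    with True obtain C' P' where C': "C = [:- x, 1:] * C'" and P': "P = [:- x, 1:] * P'"
      unfolding poly_eq_0_iff_dvd by (auto elim!: dvdE)
    have "C' \<noteq> 0" using less.prems(1) C' by auto
    moreover from this have "degree C' < degree C" unfolding C' by (subst degree_mult_eq) auto
    moreover have "fps_of_poly [:- x, 1:] * (fps_of_poly C' * B) = fps_of_poly [:- x, 1:] * fps_of_poly P'"
      using less.prems(2) unfolding C' P' fps_of_poly_mult by (simp only: mult.assoc)
    then have "fps_of_poly C' * B = fps_of_poly P'"
      using fps_of_poly_eq_iff [of "[:- x, 1:]" 0] by simp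
    ultimately show ?thesis by (intro less.hyps)
  qed
qed

text \<open>The partial sums of the digit expansion telescope to \<open>A n / k ^ n\<close>, which
  tends to \<beta>. So \<beta> is the value of a rational series at \<open>1 / k\<close>.\<close>

lemma bounded_digits_rational:
  fixes A :: "nat \<Rightarrow> int" and \<beta> :: real and C P :: "rat poly"
  assumes k: "k \<ge> 2" and A: "\<And>n. A n = \<lfloor>\<beta> * real k ^ n\<rfloor>" and A0: "A 0 = 0"
    and b: "\<And>n. b n = (if n = 0 then 0 else A n - int k * A (n - 1))"
    and C: "C \<noteq> 0" "fps_of_poly C * Abs_fps (\<lambda>n. rat_of_int (b n)) = fps_of_poly P"
    and nonneg: "\<And>n. b n \<ge> 0"
  shows "\<beta> \<in> \<rat>"
proof -
  let ?s = "\<lambda>n. real_of_int (A n) / real k ^ n"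
  have partial: "(\<Sum>i\<le>n. real_of_int (b i) / real k ^ i) = ?s n" for n
  proof (induction n)
    case 0
    show ?case by (simp add: A0 b)
  next
    case (Suc n)
    then show ?case using k by (simp add: b field_simps)
  qed
  have lim: "(\<lambda>n. \<beta> - (1 / real k) ^ n) \<longlonglongrightarrow> \<beta> - 0"
    using k by (intro tendsto_diff tendsto_const LIMSEQ_realpow_zero) auto
  have "?s \<longlonglongrightarrow> \<beta>"
  proof (rule tendsto_sandwich)
    show "(\<lambda>n. \<beta> - (1 / real k) ^ n) \<longlonglongrightarrow> \<beta>" using lim by simp
    show "(\<lambda>n. \<beta>) \<longlonglongrightarrow> \<beta>" by simp
    have "?s n \<le> \<beta>" for n
      using k of_int_floor_le [of "\<beta> * real k ^ n"] by (simp add: A field_simps)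
    then show "eventually (\<lambda>n. ?s n \<le> \<beta>) sequentially" by simp
    have "\<beta> - (1 / real k) ^ n \<le> ?s n" for n
    proof -
      have "(\<beta> * real k ^ n - 1) / real k ^ n \<le> ?s n"
        unfolding A using real_of_int_floor_gt_diff_one [of "\<beta> * real k ^ n"]
        by (intro divide_right_mono) auto
      then show ?thesis using k by (simp add: diff_divide_distrib power_one_over)
    qed
    then show "eventually (\<lambda>n. \<beta> - (1 / real k) ^ n \<le> ?s n) sequentially" by simp
  qed
  then have sums: "(\<lambda>n. real_of_int (b n) / real k ^ n) sums \<beta>"
    unfolding sums_def_le partial .
  have summand: "real_of_rat (Abs_fps (\<lambda>n. rat_of_int (b n)) $ n * (1 / rat_of_nat k) ^ n) =
      real_of_int (b n) / real k ^ n" for n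
    by (simp add: of_rat_mult of_rat_power of_rat_divide power_one_over)
  \<comment> \<open>Nonnegative digits make convergence absolute, as the Cauchy product
    requires.\<close>
  have "summable (\<lambda>n. norm (real_of_int (b n) / real k ^ n))"
    using sums_summable [OF sums] nonneg by simp
  then have "suminf (\<lambda>n. real_of_int (b n) / real k ^ n) \<in> \<rat>"
    using rational_fps_value_rational [OF C, of "1 / rat_of_nat k"] unfolding summand by blast
  with sums show ?thesis by (simp add: sums_iff)
qed

section \<open>The digit series\<close>

lemma length_digit_word:
  assumes "k \<ge> 2" "N > 0"
  shows "digit_word k N \<noteq> [] \<and> k ^ (length (digit_word k N) - 1) \<le> N \<and>
           N < k ^ length (digit_word k N)"
  using assms(2)
proof (induction N rule: less_induct)
  case (less N)
  note rec = digit_word_rec [OF assms(1) less.prems]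
  show ?case
  proof (cases "N < k")
    case True
    then show ?thesis using less.prems by (simp add: rec)
  next
    case False
    define M where "M = N div k"
    define l where "l = length (digit_word k M)"
    have M: "M > 0" "M < N"
      using False assms(1) less.prems by (auto simp: M_def div_greater_zero_iff)
    with less.IH [of M] have IH: "digit_word k M \<noteq> []" "k ^ (l - 1) \<le> M" "M < k ^ l"
      by (auto simp: l_def)
    then obtain l' where l': "l = Suc l'" by (cases l) (auto simp: l_def)
    have "N = k * M + N mod k" by (simp add: M_def)
    moreover have "N mod k < k" using assms(1) by simp
    ultimately have "k * M \<le> N" "N < k * (M + 1)" by simp_all
    moreover have "k * k ^ l' \<le> k * M" using IH l' by simp
    moreover have "k * (M + 1) \<le> k * k ^ l" using IH by (intro mult_le_mono2) simp
    ultimately have "k * k ^ l' \<le> N" "N < k * k ^ l" by (blast intro: order.trans less_le_trans)+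
    then have "k ^ l \<le> N" "N < k ^ Suc l" using l' by simp_all
    then show ?thesis by (simp add: rec M_def [symmetric] l_def [symmetric])
  qed
qed

lemma length_digit_word_iff:
  assumes "k \<ge> 2" "n > 0"
  shows "length (digit_word k N) = n \<longleftrightarrow> N \<in> {k ^ (n - 1)..<k ^ n}"
proof (cases "N = 0")
  case True
  then show ?thesis using assms by auto
next
  case False
  define l where "l = length (digit_word k N)"
  have l: "l > 0" "k ^ (l - 1) \<le> N" "N < k ^ l"
    using length_digit_word [OF assms(1), of N] False by (auto simp: l_def)
  have "l = n" if "k ^ (n - 1) \<le> N" "N < k ^ n"
  proof -
    have "k ^ (l - 1) < k ^ n" "k ^ (n - 1) < k ^ l" using l that by linarith+
    with assms(1) have "l - 1 < n" "n - 1 < l" by (simp_all add: power_less_imp_less_exp)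
    with l(1) assms(2) show ?thesis by linarith
  qed
  with l show ?thesis by (auto simp: l_def [symmetric])
qed

text \<open>\<open>digit_word\<close> maps the numbers with \<open>n\<close> digits injectively to
  words of length \<open>n\<close>; words with a leading zero digit are not in its range and
  contribute nothing.\<close>

lemma length_series_digit_series_nth:
  assumes k: "k \<ge> 2" and n: "n > 0"
  shows "length_series {..<k} ((digit_series k c)([] := 0)) $ n = (\<Sum>N = k ^ (n - 1)..<k ^ n. c N)"
proof -
  let ?W = "{w. set w \<subseteq> {..<k} \<and> length w = n}"
  have "length_series {..<k} ((digit_series k c)([] := 0)) $ n = (\<Sum>w\<in>?W. digit_series k c w)"
    unfolding length_series_nth using n by (intro sum.cong) auto
  also have "\<dots> = (\<Sum>w\<in>digit_word k ` {k ^ (n - 1)..<k ^ n}. digit_series k c w)"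
  proof (rule sum.mono_neutral_right)
    show "finite ?W" by (rule finite_lists_length_eq) simp
    show "digit_word k ` {k ^ (n - 1)..<k ^ n} \<subseteq> ?W"
      using digit_word_in_lists [of k] length_digit_word_iff [OF k n] by (auto simp: lists_eq_set)
    show "\<forall>w\<in>?W - digit_word k ` {k ^ (n - 1)..<k ^ n}. digit_series k c w = 0"
    proof
      fix w assume w: "w \<in> ?W - digit_word k ` {k ^ (n - 1)..<k ^ n}"
      have "w \<noteq> digit_word k N" for N using length_digit_word_iff [OF k n, of N] w by blast
      then show "digit_series k c w = 0" by (intro digit_series_eq_0) auto
    qed
  qed
  also have "\<dots> = (\<Sum>N = k ^ (n - 1)..<k ^ n. c N)"
    using inj_digit_word [OF k]
    by (subst sum.reindex) (auto simp: digit_series_digit_word [OF k] intro: inj_on_subset)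
  finally show ?thesis .
qed

section \<open>Explicit coefficients of the length series\<close>

text \<open>For \<open>N\<close> with \<open>n\<close> digits the logarithm lies in the interval
  from \<open>n - 1\<close> (excluded) to \<open>n\<close>, so the floor has only two possible
  values. It jumps where \<open>N + 1\<close> passes \<open>\<beta> * real k ^ n\<close>.\<close>

lemma floor_add_log:
  fixes \<alpha> :: real and k N n :: nat
  defines "a \<equiv> \<lfloor>\<alpha>\<rfloor>" and "\<beta> \<equiv> real k powr (of_int \<lfloor>\<alpha>\<rfloor> - \<alpha>)"
  assumes k: "k \<ge> 2" and n: "n > 0" and N: "k ^ (n - 1) \<le> N" "N < k ^ n"
    and irrational: "\<beta> \<notin> \<rat>"
  shows "\<lfloor>\<alpha> + log (real k) (real (N + 1))\<rfloor> =
           a + int n - 1 + (if \<lfloor>\<beta> * real k ^ n\<rfloor> \<le> int N then 1 else 0)"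
proof -
  let ?L = "log (real k) (real (N + 1))"
  have k': "1 < real k" using k by simp
  have beta: "\<beta> * real k ^ n = real k powr (real n + of_int a - \<alpha>)"
    using k by (simp add: \<beta>_def a_def powr_diff powr_add powr_realpow)
  have "real (k ^ (n - 1)) < real (N + 1)" "real (N + 1) \<le> real (k ^ n)"
    using N by (simp_all only: of_nat_less_iff of_nat_le_iff)
  moreover have "real k powr (real n - 1) = real (k ^ (n - 1))"
    using n k powr_realpow [of "real k" "n - 1"] by (simp add: of_nat_diff)
  moreover have "real k powr real n = real (k ^ n)" using k by (simp add: powr_realpow)
  ultimately have "real k powr (real n - 1) < real (N + 1)" "real (N + 1) \<le> real k powr real n"
    by (simp_all only:)
  then have L: "real n - 1 < ?L" "?L \<le> real n"
    using k' by (simp_all add: less_log_iff log_le_iff)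
  have a: "of_int a \<le> \<alpha>" "\<alpha> < of_int a + 1" by (simp_all add: a_def)
  \<comment> \<open>Equality would put the sum exactly at the jump, where the test
    \<open>\<lfloor>\<beta> * real k ^ n\<rfloor> \<le> int N\<close> fails but the floor is already
    the larger value.\<close>
  have neq: "real (N + 1) \<noteq> \<beta> * real k ^ n"
  proof
    assume "real (N + 1) = \<beta> * real k ^ n"
    then have "\<beta> = real (N + 1) / real k ^ n" using k by (simp add: field_simps)
    moreover have "real (N + 1) / real k ^ n \<in> \<rat>"
      by (intro Rats_divide Rats_power Rats_of_nat)
    ultimately show False using irrational by simp
  qed
  show ?thesis
  proof (cases "\<lfloor>\<beta> * real k ^ n\<rfloor> \<le> int N")
    case True
    then have "\<beta> * real k ^ n < real (N + 1)" by (simp add: floor_le_iff)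
    then have "real n + of_int a - \<alpha> < ?L" unfolding beta using k' by (simp add: less_log_iff)
    with L a have "\<lfloor>\<alpha> + ?L\<rfloor> = a + int n" by (intro floor_unique) auto
    with True show ?thesis by simp
  next
    case False
    then have "real (N + 1) \<le> \<beta> * real k ^ n" by (simp add: floor_le_iff)
    with neq have "real (N + 1) < \<beta> * real k ^ n" by simp
    then have "?L < real n + of_int a - \<alpha>" unfolding beta using k' by (simp add: log_less_iff)
    with L a have "\<lfloor>\<alpha> + ?L\<rfloor> = a + int n - 1" by (intro floor_unique) auto
    with False show ?thesis by simp
  qed
qed

lemma sum_floor_add_log:
  fixes \<alpha> :: real and k n :: nat
  defines "a \<equiv> \<lfloor>\<alpha>\<rfloor>" and "\<beta> \<equiv> real k powr (of_int \<lfloor>\<alpha>\<rfloor> - \<alpha>)"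
  assumes k: "k \<ge> 2" and n: "n > 0" and irrational: "\<beta> \<notin> \<rat>"
  shows "(\<Sum>N = k ^ (n - 1)..<k ^ n. \<lfloor>\<alpha> + log (real k) (real (N + 1))\<rfloor>) =
           (a + int n - 1) * (int k ^ n - int k ^ (n - 1)) + int k ^ n - \<lfloor>\<beta> * real k ^ n\<rfloor>"
proof -
  let ?A = "\<lfloor>\<beta> * real k ^ n\<rfloor>"
  \<comment> \<open>\<beta> lies between \<open>1 / k\<close> and 1, so the threshold falls inside
    the range of summation and the indices above it can be counted exactly.\<close>
  have "of_int \<lfloor>\<alpha>\<rfloor> - \<alpha> \<le> 0" "- 1 \<le> of_int \<lfloor>\<alpha>\<rfloor> - \<alpha>" by linarith+
  then have "\<beta> \<le> real k powr 0" "real k powr (- 1) \<le> \<beta>"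
    unfolding \<beta>_def using k by (intro powr_mono; simp)+
  then have "\<beta> \<le> 1" "1 / real k \<le> \<beta>"
    using k by (simp_all add: powr_minus_divide)
  then have "\<beta> * real k ^ n \<le> 1 * real k ^ n" "1 / real k * real k ^ n \<le> \<beta> * real k ^ n"
    by (intro mult_right_mono; simp)+
  moreover have "1 / real k * real k ^ n = real k ^ (n - 1)"
    using n k by (simp add: power_diff)
  ultimately have bounds: "int k ^ (n - 1) \<le> ?A" "?A \<le> int k ^ n"
    by (simp_all add: le_floor_iff floor_le_iff)
  have "k ^ (n - 1) \<le> nat ?A" using nat_mono [OF bounds(1)] by (simp flip: of_nat_power)
  then have "{k ^ (n - 1)..<k ^ n} \<inter> {N. ?A \<le> int N} = {nat ?A..<k ^ n}"
    by (auto simp flip: nat_le_iff)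
  then have "(\<Sum>N = k ^ (n - 1)..<k ^ n. if ?A \<le> int N then 1 else 0 :: int) = int (k ^ n - nat ?A)"
    by (simp only: sum.If_cases [OF finite_atLeastLessThan]) simp
  moreover have "nat ?A \<le> k ^ n" using nat_mono [OF bounds(2)] by (simp flip: of_nat_power)
  moreover have "0 \<le> ?A" by (rule order.trans [OF _ bounds(1)]) simp
  ultimately have count: "(\<Sum>N = k ^ (n - 1)..<k ^ n. if ?A \<le> int N then 1 else 0) = int k ^ n - ?A"
    by (simp only: of_nat_diff int_nat_eq of_nat_power if_True)
  have "k ^ (n - 1) \<le> k ^ n" using k by (intro power_increasing) auto
  then have card: "int (card {k ^ (n - 1)..<k ^ n}) = int k ^ n - int k ^ (n - 1)"
    by (simp add: of_nat_diff)
  have "(\<Sum>N = k ^ (n - 1)..<k ^ n. \<lfloor>\<alpha> + log (real k) (real (N + 1))\<rfloor>) =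
      (\<Sum>N = k ^ (n - 1)..<k ^ n. a + int n - 1 + (if ?A \<le> int N then 1 else 0))"
    unfolding a_def \<beta>_def
    by (intro sum.cong refl floor_add_log k n irrational [unfolded \<beta>_def]) auto
  also have "\<dots> = (a + int n - 1) * (int k ^ n - int k ^ (n - 1)) + int k ^ n - ?A"
    unfolding sum.distrib count by (simp only: sum_constant card) simp
  finally show ?thesis .
qed

theorem mainTheorem2:
  fixes k :: nat and \<alpha> :: real
  assumes "k \<ge> 2"
    and "real k powr \<alpha> \<notin> \<rat>"
  shows "\<not> nc_algebraic {..<k}
           (digit_series k (\<lambda>n. of_int \<lfloor>\<alpha> + log (real k) (real (n + 1))\<rfloor>))"
proof
  let ?f = "digit_series k (\<lambda>n. of_int \<lfloor>\<alpha> + log (real k) (real (n + 1))\<rfloor>)"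
  assume "nc_algebraic {..<k} ?f"
  then obtain r p s i where sys: "proper_system {..<k} r p" "system_solution {..<k} r p s"
    and i: "i < r" and f: "?f([] := 0) = s i"
    unfolding nc_algebraic_def by (elim conjE exE)
  define F where "F = length_series {..<k} (?f([] := 0))"
  have alg: "algebraic_fps F"
    unfolding F_def f
    by (rule system_solution_algebraic [OF proper_words_keys [OF sys(1)] finite_keys
          length_series_solves [OF finite_lessThan sys] i])
  define \<beta> where "\<beta> = real k powr (of_int \<lfloor>\<alpha>\<rfloor> - \<alpha>)"
  define A where "A = (\<lambda>n. \<lfloor>\<beta> * real k ^ n\<rfloor>)"
  \<comment> \<open>The \<open>n\<close>-th base-\<open>k\<close> digit of \<beta> after the point;
    the value at 0 agrees with \<open>A 0 = 0\<close>.\<close>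
  define b where "b = (\<lambda>n. if n = 0 then 0 else A n - int k * A (n - 1))"
  define B where "B = Abs_fps (\<lambda>n. rat_of_int (b n))"
  have irrational: "\<beta> \<notin> \<rat>"
  proof
    assume "\<beta> \<in> \<rat>"
    have "real k powr \<alpha> = real k powr of_int \<lfloor>\<alpha>\<rfloor> / \<beta>"
      using assms(1) by (simp add: \<beta>_def powr_diff)
    also have "\<dots> \<in> \<rat>"
      using assms(1) \<open>\<beta> \<in> \<rat>\<close> by (intro Rats_divide) (simp_all add: powr_real_of_int)
    finally show False using assms(2) by simp
  qed
  have "\<beta> \<le> real k powr 0" unfolding \<beta>_def using assms(1) by (intro powr_mono) (linarith, simp)
  moreover have "\<beta> \<noteq> 1" using irrational by auto
  moreover have "\<beta> \<ge> 0" by (simp add: \<beta>_def)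
  ultimately have A0: "A 0 = 0" using assms(1) by (simp add: A_def floor_eq_iff)
  have b_bounds: "0 \<le> b n \<and> b n \<le> int k" for n
  proof (cases n)
    case (Suc m)
    define y where "y = \<beta> * real k ^ m"
    have "b n = \<lfloor>real k * y\<rfloor> - int k * \<lfloor>y\<rfloor>" by (simp add: b_def Suc A_def y_def mult_ac)
    moreover have "int k * \<lfloor>y\<rfloor> \<le> \<lfloor>real k * y\<rfloor>"
      by (simp add: le_floor_iff mult_left_mono)
    moreover have "real k * y \<le> real k * (of_int \<lfloor>y\<rfloor> + 1)"
      by (intro mult_left_mono) (linarith, simp)
    then have "real k * y \<le> of_int (int k * (\<lfloor>y\<rfloor> + 1))" by simp
    then have "\<lfloor>real k * y\<rfloor> \<le> int k * (\<lfloor>y\<rfloor> + 1)"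
      using floor_mono floor_of_int by metis
    ultimately show ?thesis by (simp add: algebra_simps)
  qed (simp add: b_def)
  have F_nth: "F $ n = rat_of_int
      ((\<lfloor>\<alpha>\<rfloor> + int n - 1) * (int k ^ n - int k ^ (n - 1)) + int k ^ n - A n)" if "n > 0" for n
    unfolding F_def length_series_digit_series_nth [OF assms(1) that] of_int_sum [symmetric] A_def \<beta>_def
    by (subst sum_floor_add_log [OF assms(1) that irrational [unfolded \<beta>_def]]) (rule refl)
  \<comment> \<open>The explicit part of \<open>F_nth\<close> is \<open>k ^ n\<close> times a
    polynomial of degree 1 in \<open>n\<close>, hence annihilated by the square of \<open>L\<close>.
    On \<open>- A n\<close> one factor yields \<open>- b n\<close>, the second the combination in
    \<open>E_nth\<close>. The three indices used must be positive, hence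
    \<open>n \<ge> 3\<close>.\<close>
  define L :: "rat poly" where "L = [:1, - of_nat k:]"
  define E where "E = fps_of_poly (L ^ 2) * F"
  have L_nth: "(fps_of_poly L * G) $ Suc n = G $ Suc n - of_nat k * G $ n" for G n
    by (simp add: L_def fps_of_poly_pCons left_diff_distrib mult.assoc fps_of_poly_const flip: fps_const_neg)
  have E_nth: "E $ n = rat_of_int (int k * b (n - 1) - b n)" if "n \<ge> 3" for n
  proof -
    define m where "m = n - 3"
    then have m: "n = Suc (Suc (Suc m))" using that by simp
    have "E = fps_of_poly L * (fps_of_poly L * F)"
      by (simp add: E_def power2_eq_square fps_of_poly_mult mult.assoc)
    then have "E $ n = F $ n - of_nat k * F $ (n - 1) - of_nat k * (F $ (n - 1) - of_nat k * F $ (n - 2))"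
      by (simp add: m L_nth)
    also have "\<dots> = rat_of_int (int k * b (n - 1) - b n)"
      by (simp add: m F_nth b_def) (simp add: algebra_simps)
    finally show ?thesis .
  qed
  have L: "L \<noteq> 0" by (simp add: L_def)
  have "\<exists>C P. C \<noteq> 0 \<and> fps_of_poly C * E = fps_of_poly P"
  proof (rule algebraic_bounded_integers_imp_rational [where N = 3])
    show "algebraic_fps E" unfolding E_def using L by (intro algebraic_fps_poly_mult alg) simp
    fix n :: nat assume n: "n \<ge> 3"
    show "E $ n \<in> \<int>" by (simp only: E_nth [OF n] Ints_of_int)
    have "\<bar>int k * b (n - 1) - b n\<bar> \<le> int k * int k + int k"
    proof -
      have "int k * b (n - 1) \<le> int k * int k" "0 \<le> int k * b (n - 1)"
        using b_bounds [of "n - 1"] by (auto intro: mult_left_mono)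
      then show ?thesis using b_bounds [of n] by (simp add: abs_le_iff)
    qed
    then show "\<bar>E $ n\<bar> \<le> rat_of_int (int k * int k + int k)"
      unfolding E_nth [OF n] by (simp only: of_int_abs [symmetric] of_int_le_iff)
  qed
  then obtain C P where C: "C \<noteq> 0" "fps_of_poly C * E = fps_of_poly P" by (elim exE conjE)
  \<comment> \<open>Adding \<open>fps_of_poly L * B\<close> cancels all coefficients of
    \<open>E\<close> from index 3 on, so \<open>T\<close> is a polynomial and rationality passes
    from \<open>E\<close> to \<open>B\<close>.\<close>
  define T where "T = E + fps_of_poly L * B"
  have "T $ n = 0" if "n \<ge> 3" for n
    using that E_nth [OF that] L_nth [of B "n - 1"] by (simp add: T_def B_def)
  then have T: "T = fps_of_poly (truncate_fps 3 T)"
    by (auto simp: fps_eq_iff)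
  have "fps_of_poly (C * L) * B = fps_of_poly C * T - fps_of_poly C * E"
    by (simp add: T_def fps_of_poly_mult algebra_simps)
  also have "\<dots> = fps_of_poly (C * truncate_fps 3 T - P)"
    by (subst T) (simp only: C(2) fps_of_poly_mult fps_of_poly_diff)
  finally have "fps_of_poly (C * L) * B = fps_of_poly (C * truncate_fps 3 T - P)" .
  then have "\<beta> \<in> \<rat>"
    unfolding B_def using C(1) L b_bounds
    by (intro bounded_digits_rational [OF assms(1), of A \<beta> b "C * L"] A0) (auto simp: A_def b_def)
  with irrational show False by contradiction
qed

end
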